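(* Let $\theta_0,\theta_1,\theta_2$ satisfy $0\le\theta_i\le2\pi$, and define $\psi=(\pi-\theta_0-\theta_1-\theta_2)/2$ and $\phi_i=\psi+\theta_i$ for $i\in\{0,1,2\}$. Then there exists a simple arc-triangle whose interior angles at its three vertices (in cyclic order) are $\theta_0,\theta_1,\theta_2$ if and only if $-\pi<\phi_i<\pi$ for all $i\in\{0,1,2\}$.
   Context: An arc-polygon is a cyclic sequence alternating between points (vertices) and closed circular arcs (edges) in the Euclidean plane, each arc appearing consecutively with its two endpoints; straight line segments count as degenerate circular arcs. An arc-triangle has three vertices and three edges. An arc-polygon is simple if the only intersection points between pairs of its edges are shared vertices consecutive with both edges; its edges then form a Jordan curve bounding an interior. The interior angle at a vertex is the angle between the tangent lines of its two incident arcs at that vertex, measured through the interior of the polygon near the vertex (a value in $[0,2\pi]$). *)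

theory Defs
  imports "HOL-Analysis.Analysis"
begin

text \<open>The Euclidean plane is modelled by the complex numbers.
  A closed circular arc (possibly a straight segment) from p to q, p \<noteq> q, is
  parametrised by its signed "bulge" a with -pi < a < pi: the arc is the image of
  [0,1] under t \<mapsto> p + (q - p) * arc01 a t.  For a = 0 this is the segment [p,q];
  for a \<noteq> 0 it is the arc of central angle 2|a| of a circle through p and q,
  lying on the side of the chord determined by the sign of a.  Every closed
  circular arc with endpoints p \<noteq> q arises in this way (for a unique a).\<close>

definition arc01 :: "real \<Rightarrow> real \<Rightarrow> complex" where
  "arc01 a t = (if a = 0 then complex_of_real t
     else (exp (\<i> * complex_of_real (2 * a * t)) - 1) / (exp (\<i> * complex_of_real (2 * a)) - 1))"

definition arc_edge :: "complex \<Rightarrow> complex \<Rightarrow> real \<Rightarrow> complex set" where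
  "arc_edge p q a = (\<lambda>t. p + (q - p) * arc01 a t) ` {0..1}"

definition tri_edge :: "(nat \<Rightarrow> complex) \<Rightarrow> (nat \<Rightarrow> real) \<Rightarrow> nat \<Rightarrow> complex set" where
  "tri_edge v a i = arc_edge (v i) (v ((i + 1) mod 3)) (a i)"

definition is_arc_triangle :: "(nat \<Rightarrow> complex) \<Rightarrow> (nat \<Rightarrow> real) \<Rightarrow> bool" where
  "is_arc_triangle v a \<longleftrightarrow>
     (\<forall>i<3. v i \<noteq> v ((i + 1) mod 3) \<and> - pi < a i \<and> a i < pi)"

definition simple_arc_triangle :: "(nat \<Rightarrow> complex) \<Rightarrow> (nat \<Rightarrow> real) \<Rightarrow> bool" where
  "simple_arc_triangle v a \<longleftrightarrow> is_arc_triangle v a \<and>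
     (\<forall>i<3. \<forall>j<3. i \<noteq> j \<longrightarrow>
        tri_edge v a i \<inter> tri_edge v a j \<subseteq>
          {v k | k. k < 3 \<and> (k = i \<or> k = (i + 1) mod 3) \<and> (k = j \<or> k = (j + 1) mod 3)})"

definition tri_boundary :: "(nat \<Rightarrow> complex) \<Rightarrow> (nat \<Rightarrow> real) \<Rightarrow> complex set" where
  "tri_boundary v a = (\<Union>i<3. tri_edge v a i)"

definition tri_interior :: "(nat \<Rightarrow> complex) \<Rightarrow> (nat \<Rightarrow> real) \<Rightarrow> complex set" where
  "tri_interior v a = inside (tri_boundary v a)"

text \<open>Angle at z measured through the region R: the (Lebesgue) measure of the set of
  directions \<phi> \<in> [0,2pi) such that the ray from z in direction \<phi> lies in R
  for all sufficiently small positive lengths.  For a vertex of a simple arc-polygon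
  this is the angle between the tangent lines of the two incident arcs measured
  through the interior (including the degenerate values 0 and 2pi at cusps).\<close>
definition angle_through :: "complex set \<Rightarrow> complex \<Rightarrow> real" where
  "angle_through R z = measure lebesgue
     {\<phi> \<in> {0..<2 * pi}. \<exists>\<epsilon>>0. \<forall>s. 0 < s \<and> s < \<epsilon> \<longrightarrow> z + complex_of_real s * cis \<phi> \<in> R}"

definition interior_angle :: "(nat \<Rightarrow> complex) \<Rightarrow> (nat \<Rightarrow> real) \<Rightarrow> nat \<Rightarrow> real" where
  "interior_angle v a i = angle_through (tri_interior v a) (v i)"

end

theory Submission
  imports Defs
begin

text \<open>Let \<open>\<phi>\<^sub>i\<close> be the angle between the circumcircle and the edge opposite to the vertex \<open>i\<close>; it
  lies in \<open>(-\<pi>, \<pi>)\<close> because that edge avoids the vertex. The winding function of the boundary is a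
  sum of explicit arguments, one per edge. Its jump across an edge is \<open>2\<pi>\<close>, so it is
  \<open>\<plusminus>2\<pi>\<close> inside and \<open>0\<close> outside. Averaging its limits over all directions at a vertex therefore
  measures the interior angle, and gives \<open>\<theta>\<^sub>i = \<plusminus>(A + \<phi>\<^sub>i)\<close> with the same sign at all vertices, where
  \<open>A\<close> is the sum of the three bulges. Moreover \<open>A + \<phi>\<^sub>0 + \<phi>\<^sub>1 + \<phi>\<^sub>2\<close> is an odd multiple of \<open>\<pi>\<close>, and
  necessity follows by linear arithmetic. Conversely, three points on the unit circle with suitable
  inscribed angles carry arcs with the prescribed \<open>\<phi>\<^sub>i\<close>; after sending a common endpoint to infinity
  two such arcs become rays, which do not cross because the prescribed angles \<open>\<theta>\<^sub>i\<close> lie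
  in \<open>[0, 2\<pi>]\<close>.\<close>

section \<open>Circular arcs\<close>

lemma exp_double_minus_one:
  "exp (\<i> * complex_of_real (2 * x)) - 1 = 2 * \<i> * complex_of_real (sin x) * cis x"
proof -
  have "exp (\<i> * complex_of_real (2 * x)) = cis (2 * x)"
    by (simp add: cis_conv_exp)
  then show ?thesis
    unfolding \<open>_ = cis (2 * x)\<close>
    by (simp add: complex_eq_iff cos_double_sin sin_double power2_eq_square)
qed

text \<open>Factoring out half angles gives the polar form. As \<open>t\<close> tends to 0 the
  direction tends to \<open>- a\<close>, so the bulge is the angle between chord and
  tangent.\<close>

lemma arc01_eq_cis:
  assumes "a \<noteq> 0" "-pi < a" "a < pi"
  shows "arc01 a t = complex_of_real (sin (a * t) / sin a) * cis (a * (t - 1))"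
proof -
  have s: "sin a \<noteq> 0"
    using assms sin_eq_0_pi by blast
  have "arc01 a t = (2 * \<i> * sin (a * t) * cis (a * t)) / (2 * \<i> * sin a * cis a)"
    unfolding arc01_def using assms exp_double_minus_one[of "a * t"] exp_double_minus_one[of a]
    by (simp add: mult.assoc)
  also have "\<dots> = complex_of_real (sin (a * t) / sin a) * (cis (a * t) / cis a)"
    using s by simp
  also have "cis (a * t) / cis a = cis (a * (t - 1))"
    by (simp add: cis_divide algebra_simps)
  finally show ?thesis .
qed

lemma one_minus_arc01_eq_cis:
  assumes "a \<noteq> 0" "-pi < a" "a < pi"
  shows "1 - arc01 a t = complex_of_real (sin (a * (1 - t)) / sin a) * cis (a * t)"
proof -
  have s: "sin a \<noteq> 0"
    using assms sin_eq_0_pi by blast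
  have "sin (a * t) * cis (a * (t - 1)) + sin (a * (1 - t)) * cis (a * t) = complex_of_real (sin a)"
  proof -
    have e: "a = a * t - a * (t - 1)" "a * (1 - t) = - (a * (t - 1))"
      by (auto simp: algebra_simps)
    have "sin a = sin (a * t) * cos (a * (t - 1)) - cos (a * t) * sin (a * (t - 1))"
      by (subst e(1), subst sin_diff) simp
    then show ?thesis
      by (simp add: complex_eq_iff e(2))
  qed
  then show ?thesis
    unfolding arc01_eq_cis[OF assms] using s by (simp add: field_simps)
qed

lemma arc01_0 [simp]: "arc01 a 0 = 0"
  by (simp add: arc01_def)

lemma arc01_1:
  assumes "-pi < a" "a < pi"
  shows "arc01 a 1 = 1"
proof (cases "a = 0")
  case False
  then show ?thesis using one_minus_arc01_eq_cis[of a 1] assms by simp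
qed (simp add: arc01_def)

text \<open>The polar forms of the two chords differ in direction by
  \<open>a * t - a * (t - 1) = a\<close>. The real factor is positive because \<open>a * t\<close>
  and \<open>a * (1 - t)\<close> lie strictly between 0 and \<open>a\<close>, where sine keeps its
  sign.\<close>

lemma arc01_ratio:
  assumes "-pi < a" "a < pi" "0 < t" "t < 1"
  shows "\<exists>r>0. 1 - arc01 a t = complex_of_real r * cis a * arc01 a t \<and> arc01 a t \<noteq> 0"
proof (cases "a = 0")
  case True
  then show ?thesis
    using assms by (intro exI[of _ "(1 - t) / t"]) (simp add: arc01_def)
next
  case False
  have s: "sin a \<noteq> 0"
    using assms False sin_eq_0_pi by blast
  have pos: "sin (a * (1 - t)) / sin (a * t) > 0 \<and> sin (a * t) \<noteq> 0"
  proof (cases "a > 0")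
    case True
    then have "a * (1 - t) < pi" "a * t < pi"
      using assms by (auto intro: le_less_trans[of _ a] simp: mult_le_cancel_left1)
    then show ?thesis
      using assms True by (smt (verit) divide_pos_pos mult_pos_pos sin_gt_zero)
  next
    case neg: False
    define b where "b = - a"
    have "b > 0" "b < pi"
      using neg False assms by (auto simp: b_def)
    then have "b * (1 - t) < pi" "b * t < pi" "b * (1 - t) > 0" "b * t > 0"
      using assms by (auto intro: le_less_trans[of _ b] simp: mult_le_cancel_left1)
    then have "sin (b * (1 - t)) > 0" "sin (b * t) > 0"
      by (auto intro: sin_gt_zero)
    then show ?thesis
      by (simp add: b_def divide_neg_neg)
  qed
  have c: "cis a * cis (a * (t - 1)) = cis (a * t)"
    by (simp add: cis_mult algebra_simps)
  have "1 - arc01 a t = complex_of_real (sin (a * (1 - t)) / sin (a * t)) * cis a * arc01 a t"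
  proof -
    have "complex_of_real (sin (a * (1 - t)) / sin (a * t)) * cis a * arc01 a t
        = complex_of_real (sin (a * (1 - t)) / sin (a * t)) * complex_of_real (sin (a * t) / sin a)
          * (cis a * cis (a * (t - 1)))"
      using False assms by (simp add: arc01_eq_cis)
    also have "\<dots> = complex_of_real (sin (a * (1 - t)) / sin a) * cis (a * t)"
      using pos by (simp add: c)
    finally show ?thesis
      using False assms by (simp add: one_minus_arc01_eq_cis)
  qed
  moreover have "arc01 a t \<noteq> 0"
    using pos s False assms by (simp add: arc01_eq_cis)
  ultimately show ?thesis using pos by blast
qed

lemma one_plus_cis_neq_0:
  assumes "-pi < a" "a < pi" "r > 0"
  shows "1 + complex_of_real r * cis a \<noteq> 0"
proof
  assume "1 + complex_of_real r * cis a = 0"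
  then have *: "1 + r * cos a = 0" "r * sin a = 0"
    by (auto simp: complex_eq_iff)
  then have "a = 0"
    using assms sin_eq_0_pi by auto
  then show False using * assms by simp
qed

lemma arc01_ratio_surj:
  assumes "-pi < a" "a < pi" "r > 0"
  obtains t where "0 \<le> t" "t \<le> 1" "arc01 a t = 1 / (1 + complex_of_real r * cis a)"
proof (cases "a = 0")
  case True
  then show ?thesis
    using assms by (intro that[of "1 / (1 + r)"]) (auto simp: arc01_def)
next
  case False
  have s: "sin a \<noteq> 0"
    using assms False sin_eq_0_pi by blast
  \<comment> \<open>Division by \<open>sin a\<close> makes the end values 1 and \<open>- r\<close>
    for either sign of \<open>a\<close>, as the intermediate value theorem needs.\<close>
  let ?f = "\<lambda>t. (sin (a * (1 - t)) - r * sin (a * t)) / sin a"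
  have "\<exists>t\<ge>0. t \<le> 1 \<and> ?f t = 0"
    by (rule IVT2') (use s assms in \<open>auto intro!: continuous_intros\<close>)
  then obtain t where t: "0 \<le> t" "t \<le> 1" "sin (a * (1 - t)) = r * sin (a * t)"
    using s by auto
  have c: "cis a * cis (a * (t - 1)) = cis (a * t)"
    by (simp add: cis_mult algebra_simps)
  have "complex_of_real r * cis a * arc01 a t = 1 - arc01 a t"
    unfolding one_minus_arc01_eq_cis[OF False assms(1,2)] t(3) c[symmetric]
    using False assms by (simp add: arc01_eq_cis)
  then have "arc01 a t * (1 + complex_of_real r * cis a) = 1"
    by (simp add: algebra_simps)
  then have "arc01 a t = 1 / (1 + complex_of_real r * cis a)"
    using one_plus_cis_neq_0[OF assms] by (simp add: field_simps)
  then show ?thesis using that t by blast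
qed

text \<open>Constancy of the inscribed angle: from a point of the arc, its endpoints are seen under
  the directed angle \<open>\<pi> + a\<close>.\<close>

lemma arc_edge_iff:
  assumes "p \<noteq> q" "-pi < a" "a < pi"
  shows "z \<in> arc_edge p q a \<longleftrightarrow>
    z = p \<or> z = q \<or> (\<exists>r>0. q - z = - (complex_of_real r * cis a * (p - z)))"
    (is "_ \<longleftrightarrow> ?R")
proof
  assume "z \<in> arc_edge p q a"
  then obtain t where t: "0 \<le> t" "t \<le> 1" "z = p + (q - p) * arc01 a t"
    by (auto simp: arc_edge_def)
  consider "t = 0" | "t = 1" | "0 < t" "t < 1" using t by linarith
  then show ?R
  proof cases
    case 3
    then obtain r where r: "r > 0" "1 - arc01 a t = complex_of_real r * cis a * arc01 a t"
      using arc01_ratio assms by blast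
    have "q - z = (q - p) * (1 - arc01 a t)"
      by (simp add: t algebra_simps)
    also have "\<dots> = - (complex_of_real r * cis a * (p - z))"
      by (simp add: r t)
    finally show ?thesis using r by blast
  qed (use t arc01_1 assms in auto)
next
  assume ?R
  then consider "z = p" | "z = q" | r where "r > 0" "q - z = - (complex_of_real r * cis a * (p - z))"
    by blast
  then show "z \<in> arc_edge p q a"
  proof cases
    case 3
    obtain t where t: "0 \<le> t" "t \<le> 1" "arc01 a t = 1 / (1 + complex_of_real r * cis a)"
      using arc01_ratio_surj[OF assms(2,3) 3(1)] .
    note nz = one_plus_cis_neq_0[OF assms(2,3) 3(1)]
    have "(z - p) * (1 + complex_of_real r * cis a) = q - p"
      using 3(2) by (simp add: algebra_simps)
    then have "z = p + (q - p) * arc01 a t"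
      using nz by (simp add: t field_simps)
    then show ?thesis
      unfolding arc_edge_def using t(1,2) by (intro image_eqI[of _ _ t]) auto
  qed (use arc01_1 assms in \<open>auto simp: arc_edge_def intro: image_eqI[of _ _ 0] image_eqI[of _ _ 1]\<close>)
qed

section \<open>Circular arcs as compact Jordan arcs\<close>

lemma continuous_on_arc01 [continuous_intros]: "continuous_on S (arc01 a)"
  unfolding arc01_def by (cases "a = 0") (auto intro!: continuous_intros simp: divide_inverse)

lemma arc_arc_edge:
  assumes "p \<noteq> q" "-pi < a" "a < pi"
  shows "arc (\<lambda>t. p + (q - p) * arc01 a t)"
proof -
  have "inj_on (arc01 a) {0..1}"
  proof (cases "a = 0")
    case False
    show ?thesis
    proof (rule inj_onI)
      fix t u :: real assume tu: "t \<in> {0..1}" "u \<in> {0..1}" "arc01 a t = arc01 a u"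
      have s: "sin a \<noteq> 0"
        using assms False sin_eq_0_pi by blast
      have "cis (2 * a * t) = cis (2 * a * u)"
      proof -
        have "exp (\<i> * complex_of_real (2 * a)) - 1 \<noteq> 0"
          unfolding exp_double_minus_one using s by simp
        then have "exp (\<i> * complex_of_real (2 * a * t)) = exp (\<i> * complex_of_real (2 * a * u))"
          using tu(3) False by (simp add: arc01_def)
        then show ?thesis by (simp add: cis_conv_exp)
      qed
      then have "cis (2 * (a * (t - u))) = 1"
        by (metis cis_divide cis_neq_zero divide_self right_diff_distrib mult.assoc)
      then have "2 * \<i> * complex_of_real (sin (a * (t - u))) * cis (a * (t - u)) = 0"
        using exp_double_minus_one[of "a * (t - u)"] by (simp add: cis_conv_exp)
      then have s0: "sin (a * (t - u)) = 0"
        by simp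
      \<comment> \<open>In this range 0 is the only zero of sine.\<close>
      have "\<bar>a * (t - u)\<bar> < pi"
      proof -
        have "\<bar>a\<bar> * \<bar>t - u\<bar> \<le> \<bar>a\<bar> * 1"
          by (rule mult_left_mono) (use tu in auto)
        then show ?thesis using assms by (simp add: abs_mult)
      qed
      then have "a * (t - u) = 0"
        using sin_eq_0_pi[OF _ _ s0] by linarith
      then show "t = u" using False by simp
    qed
  qed (auto simp: arc01_def inj_on_def)
  then have "inj_on (\<lambda>t. p + (q - p) * arc01 a t) {0..1}"
    using assms by (simp add: inj_on_def)
  moreover have "continuous_on {0..1} (\<lambda>t. p + (q - p) * arc01 a t)"
    by (intro continuous_intros)
  ultimately show ?thesis by (simp add: arc_def path_def)
qed

lemma compact_arc_edge: "compact (arc_edge p q a)"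
  unfolding arc_edge_def by (intro compact_continuous_image continuous_intros) auto

section \<open>The angle swept out by an arc\<close>

text \<open>The change of the argument of \<open>\<gamma> t - z\<close> along the arc \<open>\<gamma>\<close> with bulge \<open>a\<close> from \<open>p\<close> to \<open>q\<close>:
  by the constancy of the inscribed angle, the branch cut of \<^const>\<open>Arg\<close> is hit exactly when
  \<open>z\<close> lies on the arc, and the summand \<open>a\<close> makes the value vanish at infinity.\<close>

definition swept_angle :: "complex \<Rightarrow> complex \<Rightarrow> real \<Rightarrow> complex \<Rightarrow> real" where
  "swept_angle p q a z = a + Arg ((q - z) / (p - z) * cis (- a))"

text \<open>Solving \<open>arc_edge_iff\<close> for the ratio turns the arc into the branch cut of
  \<open>Arg\<close>. Away from the endpoints the ratio is nonzero, so the point 0 of the cut does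
  not occur.\<close>

lemma in_arc_edge_iff_nonpos_Reals:
  assumes "p \<noteq> q" "-pi < a" "a < pi" "z \<noteq> p" "z \<noteq> q"
  shows "z \<in> arc_edge p q a \<longleftrightarrow> (q - z) / (p - z) * cis (- a) \<in> \<real>\<^sub>\<le>\<^sub>0"
proof -
  have eq: "q - z = - (complex_of_real r * cis a * (p - z)) \<longleftrightarrow>
      (q - z) / (p - z) * cis (- a) = complex_of_real (- r)" for r
  proof -
    have "A = - (complex_of_real r * C * D) \<longleftrightarrow> A / D * inverse C = complex_of_real (- r)"
      if "D \<noteq> 0" "C \<noteq> 0" for A C D :: complex
      using that by (auto simp: field_simps)
    from this[of "p - z" "cis a" "q - z"] show ?thesis
      using assms by (simp add: cis_inverse)
  qed
  have "(\<exists>r>0. (q - z) / (p - z) * cis (- a) = complex_of_real (- r)) \<longleftrightarrow>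
      (q - z) / (p - z) * cis (- a) \<in> \<real>\<^sub>\<le>\<^sub>0" (is "?L \<longleftrightarrow> ?R")
  proof
    assume ?L
    then obtain r where "r > 0" "(q - z) / (p - z) * cis (- a) = complex_of_real (- r)" by blast
    then show ?R by (simp only:) simp
  next
    assume ?R
    then obtain r where r: "r \<le> 0" "(q - z) / (p - z) * cis (- a) = complex_of_real r"
      by (auto elim!: nonpos_Reals_cases)
    moreover have "r \<noteq> 0" using r assms by auto
    ultimately show ?L by (intro exI[of _ "- r"]) auto
  qed
  then show ?thesis
    using assms by (simp add: arc_edge_iff eq)
qed

lemma endpoints_in_arc_edge:
  assumes "p \<noteq> q" "-pi < a" "a < pi"
  shows "p \<in> arc_edge p q a" "q \<in> arc_edge p q a"
  unfolding arc_edge_iff[OF assms] by blast+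

lemma isCont_swept_angle:
  assumes "p \<noteq> q" "-pi < a" "a < pi" "z \<notin> arc_edge p q a"
  shows "isCont (swept_angle p q a) z"
proof -
  have "z \<noteq> p" "z \<noteq> q" using endpoints_in_arc_edge assms by blast+
  then have "(q - z) / (p - z) * cis (- a) \<notin> \<real>\<^sub>\<le>\<^sub>0"
    using assms in_arc_edge_iff_nonpos_Reals by blast
  then show ?thesis
    unfolding swept_angle_def isCont_def using \<open>z \<noteq> p\<close>
    by (intro tendsto_intros) auto
qed

lemma sgn_cis [simp]: "sgn (cis x) = cis x"
  by (simp add: sgn_eq)

text \<open>The summand \<open>a\<close> undoes the rotation by \<open>cis (- a)\<close>. Hence the
  swept angle is a choice of argument of the ratio, and such ratios telescope around a closed
  polygon.\<close>

lemma cis_swept_angle: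
  assumes "z \<noteq> p" "z \<noteq> q"
  shows "cis (swept_angle p q a z) = sgn ((q - z) / (p - z))"
proof -
  have "cis (swept_angle p q a z) = cis a * sgn ((q - z) / (p - z) * cis (- a))"
    using assms by (simp add: swept_angle_def cis_mult[symmetric] cis_Arg)
  also have "\<dots> = sgn ((q - z) / (p - z)) * (cis a * cis (- a))"
    by (simp add: sgn_mult)
  finally show ?thesis by (simp add: cis_mult)
qed

text \<open>The ratio tends to 1 and \<open>cis (- a)\<close> is off the branch cut, so the
  \<open>Arg\<close> term tends to \<open>- a\<close> and cancels the summand.\<close>

lemma tendsto_swept_angle_at_infinity:
  assumes "-pi < a" "a < pi"
  shows "(swept_angle p q a \<longlongrightarrow> 0) at_infinity"
proof -
  have "((\<lambda>z. (q - p) / (p - z)) \<longlongrightarrow> 0) at_infinity"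
  proof (rule tendsto_divide_0[OF tendsto_const])
    have "filterlim (\<lambda>z::complex. norm (- z)) at_top at_infinity"
      by (simp add: filterlim_norm_at_top)
    then have "filterlim (\<lambda>z::complex. p + - z) at_infinity at_infinity"
      by (rule tendsto_add_filterlim_at_infinity[OF tendsto_const filterlim_norm_at_top_imp_at_infinity])
    then show "filterlim (\<lambda>z. p - z) at_infinity at_infinity" by simp
  qed
  then have "((\<lambda>z. 1 + (q - p) / (p - z)) \<longlongrightarrow> 1 + 0) at_infinity"
    by (intro tendsto_intros)
  moreover have "\<forall>\<^sub>F z in at_infinity. 1 + (q - p) / (p - z) = (q - z) / (p - z)"
  proof -
    have "\<forall>\<^sub>F z in at_infinity. z \<noteq> p" 
      using eventually_not_equal_at_infinity by blast
    then show ?thesis by eventually_elim (simp add: field_simps)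
  qed
  ultimately have "((\<lambda>z. (q - z) / (p - z)) \<longlongrightarrow> 1) at_infinity"
    using Lim_transform_eventually by fastforce
  then have "((\<lambda>z. (q - z) / (p - z) * cis (- a)) \<longlongrightarrow> 1 * cis (- a)) at_infinity"
    by (intro tendsto_intros)
  moreover have "cis (- a) \<notin> \<real>\<^sub>\<le>\<^sub>0"
    using assms sin_eq_0_pi[of a] by (auto simp: complex_nonpos_Reals_iff)
  ultimately have "(swept_angle p q a \<longlongrightarrow> a + Arg (1 * cis (- a))) at_infinity"
    unfolding swept_angle_def by (intro tendsto_add tendsto_const tendsto_Arg) auto
  then show ?thesis using assms by (simp add: Arg_cis)
qed

section \<open>Averages of the argument over a circle\<close>

text \<open>The argument grows at unit speed and wraps once in a full turn. On the cut
  \<open>Arg\<close> is \<open>pi\<close>, whence the non-strict inequality.\<close>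

lemma Arg_mult_cis:
  assumes "\<kappa> \<noteq> 0" "\<omega> \<in> {0..2 * pi}"
  shows "Arg (\<kappa> * cis \<omega>) = Arg \<kappa> + \<omega> - (if \<omega> \<le> pi - Arg \<kappa> then 0 else 2 * pi)"
proof (rule Arg_unique')
  show "norm \<kappa> > 0" using assms by simp
  show "Arg \<kappa> + \<omega> - (if \<omega> \<le> pi - Arg \<kappa> then 0 else 2 * pi) \<in> {- pi<..pi}"
    using assms mpi_less_Arg[of \<kappa>] Arg_le_pi[of \<kappa>] by auto
  have "\<kappa> * cis \<omega> = rcis (norm \<kappa>) (Arg \<kappa> + \<omega>)"
    by (subst rcis_cmod_Arg[of \<kappa>, symmetric]) (simp add: rcis_def cis_mult mult.assoc)
  then show "\<kappa> * cis \<omega> = rcis (norm \<kappa>) (Arg \<kappa> + \<omega> - (if \<omega> \<le> pi - Arg \<kappa> then 0 else 2 * pi))"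
    by (auto simp: rcis_def cis_divide[symmetric])
qed

lemma finite_mult_cis_nonpos_Reals:
  assumes "\<kappa> \<noteq> 0"
  shows "finite {\<omega> \<in> {0..2 * pi}. \<kappa> * cis \<omega> \<in> \<real>\<^sub>\<le>\<^sub>0}"
proof (rule finite_subset)
  \<comment> \<open>The second point lies in the interval only if \<open>Arg \<kappa> = pi\<close>,
    when the full turn returns to the cut.\<close>
  show "{\<omega> \<in> {0..2 * pi}. \<kappa> * cis \<omega> \<in> \<real>\<^sub>\<le>\<^sub>0} \<subseteq> {pi - Arg \<kappa>, 3 * pi - Arg \<kappa>}"
  proof
    fix \<omega> assume "\<omega> \<in> {\<omega> \<in> {0..2 * pi}. \<kappa> * cis \<omega> \<in> \<real>\<^sub>\<le>\<^sub>0}"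
    then have \<omega>: "\<omega> \<in> {0..2 * pi}" "\<kappa> * cis \<omega> \<in> \<real>\<^sub>\<le>\<^sub>0" by auto
    have "\<kappa> * cis \<omega> \<noteq> 0" using assms by simp
    then have "Arg (\<kappa> * cis \<omega>) = pi"
      using \<omega>(2) unfolding Arg_eq_pi complex_nonpos_Reals_iff by (auto simp: complex_eq_iff less_le)
    then show "\<omega> \<in> {pi - Arg \<kappa>, 3 * pi - Arg \<kappa>}"
      unfolding Arg_mult_cis[OF assms \<omega>(1)] by (auto split: if_splits)
  qed
qed auto

text \<open>A sawtooth passing once through its symmetric range at unit speed has mean zero. The
  integral is computed separately before and after the wrap.\<close>

lemma has_integral_Arg_mult_cis:
  assumes "\<kappa> \<noteq> 0"
  shows "((\<lambda>\<omega>. Arg (\<kappa> * cis \<omega>)) has_integral 0) {0..2 * pi}"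
proof -
  define b where "b = Arg \<kappa>"
  have b: "-pi < b" "b \<le> pi" by (auto simp: b_def mpi_less_Arg Arg_le_pi)
  define F where "F = (\<lambda>\<omega>. \<omega>\<^sup>2 / 2 + b * \<omega>)"
  have F: "(F has_vector_derivative b + \<omega>) (at \<omega> within S)" for \<omega> S
    unfolding F_def has_real_derivative_iff_has_vector_derivative[symmetric]
    by (auto intro!: derivative_eq_intros)
  have I1: "((\<lambda>\<omega>. b + \<omega>) has_integral F (pi - b) - F 0) {0..pi - b}"
    by (rule fundamental_theorem_of_calculus) (use F b in auto)
  have I2: "((\<lambda>\<omega>. b + \<omega>) has_integral F (2 * pi) - F (pi - b)) {pi - b..2 * pi}"
    by (rule fundamental_theorem_of_calculus) (use F b in auto)
  \<comment> \<open>Past the wrap the integrand drops by \<open>2 * pi\<close> on an interval of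
    length \<open>pi + b\<close>.\<close>
  from has_integral_diff[OF I2 has_integral_const_real[of "2 * pi"]]
  have I3: "((\<lambda>\<omega>. b + \<omega> - 2 * pi) has_integral F (2 * pi) - F (pi - b) - (pi + b) * (2 * pi)) {pi - b..2 * pi}"
    using b by simp
  have J1: "((\<lambda>\<omega>. Arg (\<kappa> * cis \<omega>)) has_integral F (pi - b) - F 0) {0..pi - b}"
    by (rule has_integral_eq[OF _ I1]) (use b in \<open>auto simp: Arg_mult_cis assms b_def\<close>)
  \<comment> \<open>At the wrap itself \<open>Arg\<close> is still \<open>pi\<close>, so this one
    point is discarded.\<close>
  have J2: "((\<lambda>\<omega>. Arg (\<kappa> * cis \<omega>)) has_integral F (2 * pi) - F (pi - b) - (pi + b) * (2 * pi)) {pi - b..2 * pi}"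
    by (rule has_integral_spike_finite[OF _ _ I3, of "{pi - b}"])
       (use b in \<open>auto simp: Arg_mult_cis assms b_def\<close>)
  have "((\<lambda>\<omega>. Arg (\<kappa> * cis \<omega>)) has_integral
      (F (pi - b) - F 0) + (F (2 * pi) - F (pi - b) - (pi + b) * (2 * pi))) {0..2 * pi}"
    by (rule has_integral_combine[OF _ _ J1 J2]) (use b in auto)
  also have "(F (pi - b) - F 0) + (F (2 * pi) - F (pi - b) - (pi + b) * (2 * pi)) = 0"
    by (simp add: F_def power2_eq_square algebra_simps)
  finally show ?thesis .
qed

lemma cnj_in_nonpos_Reals_iff: "cnj z \<in> \<real>\<^sub>\<le>\<^sub>0 \<longleftrightarrow> z \<in> \<real>\<^sub>\<le>\<^sub>0"
  by (simp add: complex_nonpos_Reals_iff)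

lemma finite_mult_cis_minus_nonpos_Reals:
  assumes "\<kappa> \<noteq> 0"
  shows "finite {\<omega> \<in> {0..2 * pi}. \<kappa> * cis (- \<omega>) \<in> \<real>\<^sub>\<le>\<^sub>0}"
proof -
  have "cnj \<kappa> * cis \<omega> \<in> \<real>\<^sub>\<le>\<^sub>0 \<longleftrightarrow> \<kappa> * cis (- \<omega>) \<in> \<real>\<^sub>\<le>\<^sub>0" for \<omega>
    using cnj_in_nonpos_Reals_iff[of "\<kappa> * cis (- \<omega>)"] by (simp add: cis_cnj)
  then show ?thesis
    using finite_mult_cis_nonpos_Reals[of "cnj \<kappa>"] assms by simp
qed

text \<open>Conjugation reverses the rotation and the sign of \<open>Arg\<close>, except on the
  branch cut, which finitely many angles hit.\<close>

lemma has_integral_Arg_mult_cis_minus: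
  assumes "\<kappa> \<noteq> 0"
  shows "((\<lambda>\<omega>. Arg (\<kappa> * cis (- \<omega>))) has_integral 0) {0..2 * pi}"
proof -
  have *: "((\<lambda>\<omega>. - Arg (cnj \<kappa> * cis \<omega>)) has_integral - 0) {0..2 * pi}"
    by (intro has_integral_neg has_integral_Arg_mult_cis) (use assms in simp)
  have "((\<lambda>\<omega>. Arg (\<kappa> * cis (- \<omega>))) has_integral - 0) {0..2 * pi}"
  proof (rule has_integral_spike_finite[OF finite_mult_cis_minus_nonpos_Reals[OF assms] _ *])
    fix \<omega> assume \<omega>: "\<omega> \<in> {0..2 * pi} - {\<omega> \<in> {0..2 * pi}. \<kappa> * cis (- \<omega>) \<in> \<real>\<^sub>\<le>\<^sub>0}"
    then have "Arg (cnj (\<kappa> * cis (- \<omega>))) = - Arg (\<kappa> * cis (- \<omega>))"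
      unfolding Arg_cnj by (auto simp: Arg_real complex_nonpos_Reals_iff complex_is_Real_iff)
    moreover have "cnj \<kappa> * cis \<omega> = cnj (\<kappa> * cis (- \<omega>))"
      by (simp add: cis_cnj)
    ultimately show "Arg (\<kappa> * cis (- \<omega>)) = - Arg (cnj \<kappa> * cis \<omega>)"
      by (simp only:)
  qed
  then show ?thesis by simp
qed

section \<open>Simple arc-triangles\<close>

text \<open>Named vertices and bulges, instead of indices modulo 3, make a rotated triangle another
  instance of the same locale.\<close>

locale arc_triangle =
  fixes u v w :: complex and a b c :: real
  assumes distinct: "u \<noteq> v" "v \<noteq> w" "w \<noteq> u"
    and bulge: "-pi < a" "a < pi" "-pi < b" "b < pi" "-pi < c" "c < pi"
    and edge_Int: "arc_edge u v a \<inter> arc_edge v w b \<subseteq> {v}"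
      "arc_edge v w b \<inter> arc_edge w u c \<subseteq> {w}"
      "arc_edge w u c \<inter> arc_edge u v a \<subseteq> {u}"
begin

definition boundary :: "complex set" where
  "boundary = arc_edge u v a \<union> arc_edge v w b \<union> arc_edge w u c"

text \<open>\<open>2\<pi>\<close> times the winding number of the boundary.\<close>

definition winding :: "complex \<Rightarrow> real" where
  "winding z = swept_angle u v a z + swept_angle v w b z + swept_angle w u c z"

lemma vertices_in_edges:
  "u \<in> arc_edge u v a" "v \<in> arc_edge u v a" "v \<in> arc_edge v w b"
  "w \<in> arc_edge v w b" "w \<in> arc_edge w u c" "u \<in> arc_edge w u c"
  using endpoints_in_arc_edge distinct bulge by auto

lemma opposite_not_in_edge:
  "u \<notin> arc_edge v w b" "v \<notin> arc_edge w u c" "w \<notin> arc_edge u v a"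
  using vertices_in_edges edge_Int distinct by auto

lemma closed_edges: "closed (arc_edge p q d)"
  by (simp add: compact_arc_edge compact_imp_closed)

lemma boundary_eq_path_image:
  obtains g where "simple_path g" "pathfinish g = pathstart g" "path_image g = boundary"
proof -
  define e where "e = (\<lambda>p q d t. p + (q - p) * arc01 d t)"
  have im: "path_image (e p q d) = arc_edge p q d" for p q d
    by (simp add: path_image_def e_def arc_edge_def)
  have st: "pathstart (e p q d) = p" for p q d
    by (simp add: e_def pathstart_def)
  have fin: "pathfinish (e u v a) = v" "pathfinish (e v w b) = w" "pathfinish (e w u c) = u"
    using bulge by (auto simp: e_def pathfinish_def arc01_1)
  have arcs: "arc (e u v a)" "arc (e v w b)" "arc (e w u c)"
    unfolding e_def using arc_arc_edge distinct bulge by auto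
  have arc2: "arc (e v w b +++ e w u c)"
    using edge_Int by (intro arc_join arcs) (auto simp: im st fin)
  show ?thesis
  proof
    show "simple_path (e u v a +++ (e v w b +++ e w u c))"
      by (rule simple_path_join_loop[OF arcs(1) arc2])
        (use edge_Int in \<open>auto simp: st fin im path_image_join\<close>)
    show "pathfinish (e u v a +++ (e v w b +++ e w u c)) = pathstart (e u v a +++ (e v w b +++ e w u c))"
      by (simp add: st fin)
    show "path_image (e u v a +++ (e v w b +++ e w u c)) = boundary"
      by (simp add: st fin im path_image_join boundary_def Un_assoc)
  qed
qed

section \<open>The winding function off the boundary\<close>

lemma isCont_winding:
  assumes "z \<notin> boundary"
  shows "isCont winding z"
  unfolding winding_def
  by (intro continuous_intros isCont_swept_angle) (use assms distinct bulge in \<open>auto simp: boundary_def\<close>)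

text \<open>The three ratios telescope to 1, so \<open>cis\<close> of the sum is 1.\<close>

lemma winding_integral:
  assumes "z \<notin> boundary"
  shows "\<exists>n::int. winding z = 2 * pi * n"
proof -
  have nz: "z \<noteq> u" "z \<noteq> v" "z \<noteq> w"
    using assms vertices_in_edges by (auto simp: boundary_def)
  have "cis (winding z) = sgn ((v - z) / (u - z) * ((w - z) / (v - z)) * ((u - z) / (w - z)))"
    unfolding winding_def cis_mult[symmetric] sgn_mult using nz by (simp add: cis_swept_angle)
  also have "(v - z) / (u - z) * ((w - z) / (v - z)) * ((u - z) / (w - z)) = 1"
    using nz by (auto simp: divide_simps)
  finally have "cos (winding z) = 1"
    by (simp add: complex_eq_iff)
  then show ?thesis
    by (auto simp: cos_one_2pi_int mult_ac)
qed

text \<open>A continuous function whose distinct values are at least \<open>2 * pi\<close> apart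
  cannot vary on a connected set.\<close>

lemma winding_constant:
  assumes "connected S" "S \<inter> boundary = {}"
  shows "winding constant_on S"
proof (rule continuous_discrete_range_constant[OF assms(1)])
  show "continuous_on S winding"
    using assms isCont_winding by (intro continuous_at_imp_continuous_on) auto
  fix x assume x: "x \<in> S"
  have "2 * pi \<le> norm (winding y - winding x)" if y: "y \<in> S" "winding y \<noteq> winding x" for y
  proof -
    obtain n m :: int where nm: "winding x = 2 * pi * n" "winding y = 2 * pi * m"
      using winding_integral assms x y by (metis disjoint_iff)
    then have "\<bar>m - n\<bar> \<ge> 1" using y by auto
    then have "2 * pi * 1 \<le> 2 * pi * real_of_int \<bar>m - n\<bar>"
      by (intro mult_left_mono) auto
    also have "\<dots> = norm (winding y - winding x)"
      by (simp add: nm abs_mult flip: right_diff_distrib)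
    finally show ?thesis by simp
  qed
  then show "\<exists>e>0. \<forall>y. y \<in> S \<and> winding y \<noteq> winding x \<longrightarrow> e \<le> norm (winding y - winding x)"
    by (intro exI[of _ "2 * pi"]) auto
qed

lemma tendsto_winding_at_infinity: "(winding \<longlongrightarrow> 0) at_infinity"
proof -
  have "(winding \<longlongrightarrow> 0 + 0 + 0) at_infinity"
    unfolding winding_def by (intro tendsto_add tendsto_swept_angle_at_infinity bulge)
  then show ?thesis by simp
qed

text \<open>By the Jordan curve theorem both sides are connected, so the winding is constant on
  each. The outside is unbounded, so its constant is the limit 0 at infinity.\<close>

lemma winding_inside_outside:
  obtains K where "\<And>z. z \<notin> boundary \<Longrightarrow> winding z = (if z \<in> inside boundary then K else 0)"
proof -
  obtain g where g: "simple_path g" "pathfinish g = pathstart g" "path_image g = boundary"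
    by (rule boundary_eq_path_image)
  note J = Jordan_inside_outside[OF g(1,2), unfolded g(3)]
  obtain K where K: "\<And>z. z \<in> inside boundary \<Longrightarrow> winding z = K"
    using winding_constant[of "inside boundary"] J by (auto simp: constant_on_def)
  obtain k where k: "\<And>z. z \<in> outside boundary \<Longrightarrow> winding z = k"
    using winding_constant[of "outside boundary"] J by (auto simp: constant_on_def)
  have "k = 0"
  proof (rule ccontr)
    assume "k \<noteq> 0"
    then have "\<forall>\<^sub>F z in at_infinity. dist (winding z) 0 < \<bar>k\<bar>"
      using tendsto_winding_at_infinity tendstoD by fastforce
    then obtain M where M: "\<And>z. norm z \<ge> M \<Longrightarrow> \<bar>winding z\<bar> < \<bar>k\<bar>"
      by (auto simp: eventually_at_infinity)
    have "\<not> bounded (outside boundary)" using J by blast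
    then obtain z where "z \<in> outside boundary" "norm z > M"
      unfolding bounded_iff by (meson not_le)
    then show False using M[of z] k[of z] by auto
  qed
  then show ?thesis
    using that[of K] K k J by (metis Compl_iff Un_iff)
qed

text \<open>Approaching an interior point of an edge from both sides, the swept angle of this edge
  tends to \<open>a + \<pi>\<close> and to \<open>a - \<pi>\<close>, while the other two are continuous.\<close>

lemma winding_jump:
  assumes K: "\<And>z. z \<notin> boundary \<Longrightarrow> winding z = (if z \<in> inside boundary then K else 0)"
  shows "K = 2 * pi \<or> K = - 2 * pi"
proof -
  \<comment> \<open>This is the midpoint of the arc from \<open>u\<close> to \<open>v\<close> with
    bulge \<open>a + \<epsilon>\<close>; it crosses the edge at \<epsilon> = 0.\<close>
  define \<zeta> where "\<zeta> = (\<lambda>\<epsilon>. (v + cis (a + \<epsilon>) * u) / (1 + cis (a + \<epsilon>)))"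
  have den: "1 + cis (a + \<epsilon>) \<noteq> 0" if "\<bar>\<epsilon>\<bar> < pi - \<bar>a\<bar>" for \<epsilon>
    using one_plus_cis_neq_0[of "a + \<epsilon>" 1] that by auto
  have a0: "0 < pi - \<bar>a\<bar>" using bulge by auto
  have ratio: "(v - \<zeta> \<epsilon>) / (u - \<zeta> \<epsilon>) = - cis (a + \<epsilon>)" "\<zeta> \<epsilon> \<noteq> u" "\<zeta> \<epsilon> \<noteq> v"
    if "\<bar>\<epsilon>\<bar> < pi - \<bar>a\<bar>" for \<epsilon>
  proof -
    have 1: "u - \<zeta> \<epsilon> = (u - v) / (1 + cis (a + \<epsilon>))"
      using den[OF that] by (simp add: \<zeta>_def field_simps)
    have 2: "v - \<zeta> \<epsilon> = - cis (a + \<epsilon>) * ((u - v) / (1 + cis (a + \<epsilon>)))"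
      using den[OF that] by (simp add: \<zeta>_def field_simps)
    show "\<zeta> \<epsilon> \<noteq> u" "\<zeta> \<epsilon> \<noteq> v" using 1 2 den[OF that] distinct by auto
    show "(v - \<zeta> \<epsilon>) / (u - \<zeta> \<epsilon>) = - cis (a + \<epsilon>)"
      unfolding 1 2 using den[OF that] distinct by simp
  qed
  define x where "x = \<zeta> 0"
  have "x \<in> arc_edge u v a"
    unfolding x_def using ratio[of 0] a0 distinct bulge
    by (subst in_arc_edge_iff_nonpos_Reals) (auto simp: cis_mult)
  moreover have "x \<noteq> u" "x \<noteq> v" using ratio[of 0] a0 by (auto simp: x_def)
  ultimately have x: "x \<notin> arc_edge v w b" "x \<notin> arc_edge w u c"
    using edge_Int by auto
  have lim: "((\<lambda>\<epsilon>. \<zeta> (\<sigma> * \<epsilon>)) \<longlongrightarrow> x) (at_right 0)" for \<sigma> :: real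
  proof -
    have "((\<lambda>\<epsilon>. (v + cis (a + \<sigma> * \<epsilon>) * u) / (1 + cis (a + \<sigma> * \<epsilon>))) \<longlongrightarrow>
        (v + cis (a + \<sigma> * 0) * u) / (1 + cis (a + \<sigma> * 0))) (at_right 0)"
      by (intro tendsto_intros) (use den[of 0] a0 in auto)
    then show ?thesis by (simp add: \<zeta>_def x_def)
  qed
  \<comment> \<open>The winding at the crossing point without the \<open>Arg\<close> term of the
    crossed edge; the one-sided limits are \<open>B - pi\<close> and \<open>B + pi\<close>.\<close>
  define B where "B = a + swept_angle v w b x + swept_angle w u c x"
  have side: "B - \<sigma> * pi \<in> {0, K}" if \<sigma>: "\<sigma> = 1 \<or> \<sigma> = - 1" for \<sigma> :: real
  proof -
    have small: "\<forall>\<^sub>F \<epsilon> in at_right 0. 0 < \<epsilon> \<and> \<epsilon> < min (pi - \<bar>a\<bar>) pi"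
      using a0 by (intro eventually_at_rightI[of 0 "min (pi - \<bar>a\<bar>) pi"]) auto
    have off: "\<forall>\<^sub>F \<epsilon> in at_right 0. \<zeta> (\<sigma> * \<epsilon>) \<in> - (arc_edge v w b \<union> arc_edge w u c)"
      using x by (intro topological_tendstoD[OF lim] open_Compl closed_Un closed_edges) auto
    have "\<forall>\<^sub>F \<epsilon> in at_right 0. swept_angle u v a (\<zeta> (\<sigma> * \<epsilon>)) = a + \<sigma> * (\<epsilon> - pi) \<and>
        \<zeta> (\<sigma> * \<epsilon>) \<notin> arc_edge u v a"
      using small
    proof eventually_elim
      case (elim \<epsilon>)
      then have e: "\<bar>\<sigma> * \<epsilon>\<bar> < pi - \<bar>a\<bar>" using \<sigma> by auto
      have "(v - \<zeta> (\<sigma> * \<epsilon>)) / (u - \<zeta> (\<sigma> * \<epsilon>)) * cis (- a) = - cis (\<sigma> * \<epsilon>)"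
        unfolding ratio(1)[OF e] by (simp add: cis_mult)
      \<comment> \<open>The representative \<open>\<sigma> * (\<epsilon> - pi)\<close> lies in the
        range of \<open>Arg\<close>, which therefore returns it.\<close>
      also have "\<dots> = cis (\<sigma> * (\<epsilon> - pi))"
        using \<sigma> by (auto simp: complex_eq_iff)
      finally have r: "(v - \<zeta> (\<sigma> * \<epsilon>)) / (u - \<zeta> (\<sigma> * \<epsilon>)) * cis (- a) = cis (\<sigma> * (\<epsilon> - pi))" .
      have "sin (\<sigma> * (\<epsilon> - pi)) \<noteq> 0"
        using \<sigma> elim sin_gt_zero[of \<epsilon>] by fastforce
      then have "cis (\<sigma> * (\<epsilon> - pi)) \<notin> \<real>\<^sub>\<le>\<^sub>0"
        by (auto simp: complex_nonpos_Reals_iff)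
      then have "\<zeta> (\<sigma> * \<epsilon>) \<notin> arc_edge u v a"
        using ratio(2,3)[OF e] distinct bulge by (subst in_arc_edge_iff_nonpos_Reals) (simp_all only: r not_False_eq_True)
      moreover have "Arg (cis (\<sigma> * (\<epsilon> - pi))) = \<sigma> * (\<epsilon> - pi)"
        using elim \<sigma> by (intro Arg_cis) auto
      ultimately show ?case
        unfolding swept_angle_def r by simp
    qed
    then have ev: "\<forall>\<^sub>F \<epsilon> in at_right 0. a + \<sigma> * (\<epsilon> - pi) + swept_angle v w b (\<zeta> (\<sigma> * \<epsilon>))
        + swept_angle w u c (\<zeta> (\<sigma> * \<epsilon>)) \<in> {0, K}"
      using off
    proof eventually_elim
      case (elim \<epsilon>)
      then have "\<zeta> (\<sigma> * \<epsilon>) \<notin> boundary" by (auto simp: boundary_def)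
      from K[OF this] show ?case using elim by (auto simp: winding_def)
    qed
    have "((\<lambda>\<epsilon>. a + \<sigma> * (\<epsilon> - pi) + swept_angle v w b (\<zeta> (\<sigma> * \<epsilon>))
        + swept_angle w u c (\<zeta> (\<sigma> * \<epsilon>))) \<longlongrightarrow>
        a + \<sigma> * (0 - pi) + swept_angle v w b x + swept_angle w u c x) (at_right 0)"
      by (intro tendsto_intros isCont_tendsto_compose[OF isCont_swept_angle lim])
        (use x distinct bulge in auto)
    then have "a + \<sigma> * (0 - pi) + swept_angle v w b x + swept_angle w u c x \<in> {0, K}"
      by (intro Lim_in_closed_set[OF _ ev]) auto
    then show ?thesis by (auto simp: B_def algebra_simps)
  qed
  \<comment> \<open>Both limits lie in \<open>{0, K}\<close> and differ by \<open>2 * pi\<close>, so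
    one is 0 and the other is \<open>K\<close>.\<close>
  show ?thesis using side[of 1] side[of "-1"] by auto
qed

section \<open>Interior angles from the winding function\<close>

lemma rotate: "arc_triangle v w u b c a"
  using distinct bulge edge_Int by unfold_locales auto

text \<open>The limit of the winding function along a ray emanating from \<open>u\<close> is \<open>K\<close>
  exactly for the directions into the interior, and the terms that depend on the direction average
  to zero over the circle of directions.\<close>

lemma angle_at_vertex:
  assumes K: "\<And>z. z \<notin> boundary \<Longrightarrow> winding z = (if z \<in> inside boundary then K else 0)"
  shows "K * angle_through (inside boundary) u = 2 * pi * (a + c + swept_angle v w b u)"
proof -
  \<comment> \<open>Along the ray \<open>u + s * cis \<omega>\<close> the expressions under
    \<open>Arg\<close> for the edges at \<open>u\<close> are positive multiples of quantities
    tending to \<open>\<kappa>1 * cis (- \<omega>)\<close> and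
    \<open>\<kappa>2 * cis \<omega>\<close>.\<close>
  define \<kappa>1 where "\<kappa>1 = - (v - u) * cis (- a)"
  define \<kappa>2 where "\<kappa>2 = - cis (- c) / (w - u)"
  have \<kappa>: "\<kappa>1 \<noteq> 0" "\<kappa>2 \<noteq> 0" using distinct by (auto simp: \<kappa>1_def \<kappa>2_def)
  define L where "L = (\<lambda>\<omega>. a + c + swept_angle v w b u + Arg (\<kappa>1 * cis (- \<omega>)) + Arg (\<kappa>2 * cis \<omega>))"
  \<comment> \<open>The exceptional directions are the tangents to the two edges at
    \<open>u\<close>, where a limit falls on the branch cut, and \<open>2 * pi\<close>, which the
    half-open range in \<open>angle_through\<close> omits.\<close>
  define F where "F = {\<omega> \<in> {0..2 * pi}. \<kappa>1 * cis (- \<omega>) \<in> \<real>\<^sub>\<le>\<^sub>0} \<union>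
    {\<omega> \<in> {0..2 * pi}. \<kappa>2 * cis \<omega> \<in> \<real>\<^sub>\<le>\<^sub>0} \<union> {2 * pi}"
  have finF: "finite F"
    unfolding F_def using \<kappa> finite_mult_cis_nonpos_Reals finite_mult_cis_minus_nonpos_Reals by auto
  define D where "D = {\<phi> \<in> {0..<2 * pi}. \<exists>\<epsilon>>0. \<forall>s. 0 < s \<and> s < \<epsilon> \<longrightarrow>
    u + complex_of_real s * cis \<phi> \<in> inside boundary}"
  have K0: "K \<noteq> 0" using winding_jump[OF K] by auto
  have L_eq: "L \<omega> = K * indicator D \<omega>" if \<omega>: "\<omega> \<in> {0..2 * pi}" "\<omega> \<notin> F" for \<omega>
  proof -
    define z where "z = (\<lambda>s. u + complex_of_real s * cis \<omega>)"
    have D_iff: "\<omega> \<in> D \<longleftrightarrow> (\<forall>\<^sub>F s in at_right 0. z s \<in> inside boundary)"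
      using \<omega> by (auto simp: D_def F_def z_def eventually_at_right_field)
    have n1: "\<kappa>1 * cis (- \<omega>) \<notin> \<real>\<^sub>\<le>\<^sub>0" and n2: "\<kappa>2 * cis \<omega> \<notin> \<real>\<^sub>\<le>\<^sub>0"
      using \<omega> by (auto simp: F_def)
    have pos: "\<forall>\<^sub>F s in at_right (0::real). 0 < s"
      by (simp add: eventually_at_right_less)
    have lz: "(z \<longlongrightarrow> u) (at_right 0)"
    proof -
      have "((\<lambda>s. u + complex_of_real s * cis \<omega>) \<longlongrightarrow> u + complex_of_real 0 * cis \<omega>) (at_right 0)"
        by (intro tendsto_intros)
      then show ?thesis by (simp add: z_def)
    qed
    have avoid: "\<forall>\<^sub>F s in at_right 0. z s \<in> - arc_edge v w b \<inter> - {v} \<inter> - {w}"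
      by (intro topological_tendstoD[OF lz] open_Int open_Compl closed_edges)
        (use opposite_not_in_edge distinct in auto)
    have l1: "((\<lambda>s. (v - z s) * - cis (- \<omega>) * cis (- a)) \<longlongrightarrow> \<kappa>1 * cis (- \<omega>)) (at_right 0)"
    proof -
      have "((\<lambda>s. (v - z s) * - cis (- \<omega>) * cis (- a)) \<longlongrightarrow> (v - u) * - cis (- \<omega>) * cis (- a)) (at_right 0)"
        by (intro tendsto_intros lz)
      also have "(v - u) * - cis (- \<omega>) * cis (- a) = \<kappa>1 * cis (- \<omega>)"
        by (simp add: \<kappa>1_def algebra_simps)
      finally show ?thesis .
    qed
    have l2: "((\<lambda>s. - cis \<omega> / (w - z s) * cis (- c)) \<longlongrightarrow> \<kappa>2 * cis \<omega>) (at_right 0)"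
    proof -
      have "((\<lambda>s. - cis \<omega> / (w - z s) * cis (- c)) \<longlongrightarrow> - cis \<omega> / (w - u) * cis (- c)) (at_right 0)"
        by (intro tendsto_intros lz) (use distinct in auto)
      then show ?thesis by (simp add: \<kappa>2_def mult_ac)
    qed
    have s1: "(v - z s) / (u - z s) * cis (- a) =
        complex_of_real (1 / s) * ((v - z s) * - cis (- \<omega>) * cis (- a))" if "s > 0" for s
    proof -
      have "u - z s = - (complex_of_real s * cis \<omega>)" by (simp add: z_def)
      then have "(v - z s) / (u - z s) = (v - z s) * (- (1 / complex_of_real s) * cis (- \<omega>))"
        by (simp add: divide_inverse cis_inverse)
      then show ?thesis by simp
    qed
    have s2: "(u - z s) / (w - z s) * cis (- c) =
        complex_of_real s * (- cis \<omega> / (w - z s) * cis (- c))" for s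
      by (simp add: z_def)
    have e1: "\<forall>\<^sub>F s in at_right 0. (v - z s) * - cis (- \<omega>) * cis (- a) \<in> - \<real>\<^sub>\<le>\<^sub>0"
      by (intro topological_tendstoD[OF l1]) (use n1 in auto)
    have e2: "\<forall>\<^sub>F s in at_right 0. - cis \<omega> / (w - z s) * cis (- c) \<in> - \<real>\<^sub>\<le>\<^sub>0"
      by (intro topological_tendstoD[OF l2]) (use n2 in auto)
    have scale: "complex_of_real r * y \<in> \<real>\<^sub>\<le>\<^sub>0 \<longleftrightarrow> y \<in> \<real>\<^sub>\<le>\<^sub>0" if "r > 0" for r y
      using that by (auto simp: complex_nonpos_Reals_iff mult_le_0_iff)
    have off: "\<forall>\<^sub>F s in at_right 0. z s \<notin> boundary"
      using pos avoid e1 e2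
    proof eventually_elim
      case (elim s)
      have "z s \<noteq> u" using elim by (simp add: z_def)
      have "(v - z s) / (u - z s) * cis (- a) \<notin> \<real>\<^sub>\<le>\<^sub>0"
        unfolding s1[OF elim(1)] using elim by (subst scale) auto
      then have "z s \<notin> arc_edge u v a"
        using elim distinct bulge \<open>z s \<noteq> u\<close> in_arc_edge_iff_nonpos_Reals by blast
      moreover have "(u - z s) / (w - z s) * cis (- c) \<notin> \<real>\<^sub>\<le>\<^sub>0"
        unfolding s2 using elim by (subst scale) auto
      then have "z s \<notin> arc_edge w u c"
        using elim distinct bulge \<open>z s \<noteq> u\<close> in_arc_edge_iff_nonpos_Reals by blast
      ultimately show ?case using elim by (auto simp: boundary_def)
    qed
    have val: "\<forall>\<^sub>F s in at_right 0. a + Arg ((v - z s) * - cis (- \<omega>) * cis (- a)) +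
        swept_angle v w b (z s) + (c + Arg (- cis \<omega> / (w - z s) * cis (- c))) = winding (z s)"
      using pos
    proof eventually_elim
      case (elim s)
      have "Arg ((v - z s) / (u - z s) * cis (- a)) = Arg ((v - z s) * - cis (- \<omega>) * cis (- a))"
        unfolding s1[OF elim] using elim by (intro Arg_times_of_real) simp
      moreover have "Arg ((u - z s) / (w - z s) * cis (- c)) = Arg (- cis \<omega> / (w - z s) * cis (- c))"
        unfolding s2 using elim by (intro Arg_times_of_real)
      ultimately show ?case unfolding winding_def swept_angle_def by (simp only:)
    qed
    have "((\<lambda>s. a + Arg ((v - z s) * - cis (- \<omega>) * cis (- a)) +
        swept_angle v w b (z s) + (c + Arg (- cis \<omega> / (w - z s) * cis (- c)))) \<longlongrightarrow>
        a + Arg (\<kappa>1 * cis (- \<omega>)) + swept_angle v w b u + (c + Arg (\<kappa>2 * cis \<omega>))) (at_right 0)"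
      by (intro tendsto_add tendsto_const tendsto_Arg l1 l2 n1 n2
          isCont_tendsto_compose[OF isCont_swept_angle lz])
        (use distinct bulge opposite_not_in_edge in auto)
    then have lim: "((\<lambda>s. winding (z s)) \<longlongrightarrow> L \<omega>) (at_right 0)"
      using Lim_transform_eventually[OF _ val] by (simp add: L_def add_ac)
    have mem: "\<forall>\<^sub>F s in at_right 0. winding (z s) \<in> {0, K}"
      using off by eventually_elim (auto simp: K)
    have "L \<omega> \<in> {0, K}"
      by (intro Lim_in_closed_set[OF _ mem _ lim]) auto
    moreover have "\<forall>\<^sub>F s in at_right 0. dist (winding (z s)) (L \<omega>) < \<bar>K\<bar>"
      using tendstoD[OF lim] K0 by auto
    \<comment> \<open>The only values are 0 and \<open>K\<close>, so being closer than
      \<open>\<bar>K\<bar>\<close> to the limit means equality.\<close>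
    then have near: "\<forall>\<^sub>F s in at_right 0. winding (z s) = L \<omega>"
      using mem by eventually_elim (use \<open>L \<omega> \<in> {0, K}\<close> in \<open>auto simp: dist_real_def\<close>)
    ultimately consider "L \<omega> = K" | "L \<omega> = 0" by auto
    then show ?thesis
    proof cases
      case 1
      have "\<forall>\<^sub>F s in at_right 0. z s \<in> inside boundary"
        using near off by eventually_elim (use 1 K K0 in \<open>auto split: if_splits\<close>)
      then show ?thesis using D_iff 1 by simp
    next
      case 2
      have out: "\<forall>\<^sub>F s in at_right 0. z s \<notin> inside boundary"
        using near off by eventually_elim (use 2 K K0 in \<open>auto split: if_splits\<close>)
      have "\<omega> \<notin> D"
      proof
        assume "\<omega> \<in> D"
        then have "\<forall>\<^sub>F s in at_right 0. z s \<in> inside boundary"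
          using D_iff by blast
        then have "\<forall>\<^sub>F s in at_right (0::real). False"
          using out by eventually_elim blast
        then show False by simp
      qed
      then show ?thesis using 2 by simp
    qed
  qed
  have "((\<lambda>\<omega>. a + c + swept_angle v w b u) has_integral (2 * pi) * (a + c + swept_angle v w b u)) {0..2 * pi}"
    using has_integral_const_real[of "a + c + swept_angle v w b u" 0 "2 * pi"] by simp
  from has_integral_add[OF has_integral_add[OF this has_integral_Arg_mult_cis_minus[OF \<kappa>(1)]]
      has_integral_Arg_mult_cis[OF \<kappa>(2)]]
  have intL: "(L has_integral (2 * pi) * (a + c + swept_angle v w b u)) {0..2 * pi}"
    by (simp add: L_def)
  have "((\<lambda>\<omega>. K * indicator D \<omega>) has_integral (2 * pi) * (a + c + swept_angle v w b u)) {0..2 * pi}"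
    by (rule has_integral_spike_finite[OF finF _ intL]) (use L_eq in auto)
  then have "((\<lambda>\<omega>. (1 / K) * (K * indicator D \<omega>)) has_integral
      (1 / K) * ((2 * pi) * (a + c + swept_angle v w b u))) {0..2 * pi}"
    by (rule has_integral_mult_right)
  then have "((\<lambda>\<omega>. indicat_real D \<omega>) has_integral (2 * pi) * (a + c + swept_angle v w b u) / K) {0..2 * pi}"
    using K0 by simp
  then have "((\<lambda>\<omega>. if \<omega> \<in> {0..2 * pi} then indicat_real D \<omega> else 0) has_integral
      (2 * pi) * (a + c + swept_angle v w b u) / K) UNIV"
    by (simp only: has_integral_restrict_UNIV)
  moreover have "(\<lambda>\<omega>. if \<omega> \<in> {0..2 * pi} then indicat_real D \<omega> else 0) = indicat_real D"
  proof -
    have "D \<subseteq> {0..2 * pi}" by (auto simp: D_def)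
    then show ?thesis by (auto simp: fun_eq_iff indicator_def)
  qed
  \<comment> \<open>Integrability of the indicator yields measurability of \<open>D\<close> along
    with its measure.\<close>
  ultimately have "measure lebesgue D = (2 * pi) * (a + c + swept_angle v w b u) / K"
    using lmeasurable_iff_indicator_has_integral by metis
  then show ?thesis
    using K0 by (simp add: angle_through_def D_def)
qed

text \<open>The remaining ambiguity of sign is the orientation of the boundary curve.\<close>

lemma interior_angles:
  obtains \<sigma> :: real where "\<sigma> = 1 \<or> \<sigma> = - 1"
    "angle_through (inside boundary) u = \<sigma> * (a + c + swept_angle v w b u)"
    "angle_through (inside boundary) v = \<sigma> * (b + a + swept_angle w u c v)"
    "angle_through (inside boundary) w = \<sigma> * (c + b + swept_angle u v a w)"
proof -
  interpret rot: arc_triangle v w u b c a by (rule rotate)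
  interpret rot2: arc_triangle w u v c a b by (rule rot.rotate)
  \<comment> \<open>Rotation preserves boundary and winding, so a single \<open>K\<close>, hence a
    single sign, serves all three vertices.\<close>
  have B: "rot.boundary = boundary" "rot2.boundary = boundary"
    by (auto simp: boundary_def rot.boundary_def rot2.boundary_def)
  have W: "rot.winding = winding" "rot2.winding = winding"
    by (auto simp: fun_eq_iff winding_def rot.winding_def rot2.winding_def)
  obtain K where K: "\<And>z. z \<notin> boundary \<Longrightarrow> winding z = (if z \<in> inside boundary then K else 0)"
    using winding_inside_outside by blast
  have K1: "\<And>z. z \<notin> rot.boundary \<Longrightarrow> rot.winding z = (if z \<in> inside rot.boundary then K else 0)"
    and K2: "\<And>z. z \<notin> rot2.boundary \<Longrightarrow> rot2.winding z = (if z \<in> inside rot2.boundary then K else 0)"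
    unfolding B W by (rule K, assumption)+
  \<comment> \<open>\<open>K\<close> is \<open>2 * pi\<close> up to sign, so
    \<open>K / (2 * pi)\<close> is its own inverse and may change sides; it becomes
    \<sigma>.\<close>
  have *: "x = K / (2 * pi) * y" if "K * x = 2 * pi * y" for x y
  proof -
    have "K * K = (2 * pi) * (2 * pi)" using winding_jump[OF K] by auto
    then have "(2 * pi) * (2 * pi * x) = (2 * pi) * (K * y)"
      using that by (metis mult.assoc mult.left_commute)
    then show ?thesis by (simp add: field_simps)
  qed
  have "K / (2 * pi) = 1 \<or> K / (2 * pi) = - 1" using winding_jump[OF K] by auto
  then show ?thesis
    using that *[OF angle_at_vertex[OF K]]
      *[OF rot.angle_at_vertex[OF K1]] *[OF rot2.angle_at_vertex[OF K2]]
    unfolding B by blast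
qed

text \<open>Each deviation is a bare \<open>Arg\<close> term, and it differs from \<open>pi\<close>
  because the opposite vertex is off the edge. The total is an odd multiple of \<open>pi\<close>
  because the three ratios at the opposite vertices multiply to -1.\<close>

lemma opposite_swept_angles:
  defines "\<phi>0 \<equiv> swept_angle v w b u - b"
    and "\<phi>1 \<equiv> swept_angle w u c v - c"
    and "\<phi>2 \<equiv> swept_angle u v a w - a"
  shows "- pi < \<phi>0" "\<phi>0 < pi" "- pi < \<phi>1" "\<phi>1 < pi" "- pi < \<phi>2" "\<phi>2 < pi"
    and "\<exists>m. a + b + c + \<phi>0 + \<phi>1 + \<phi>2 = real_of_int (2 * m + 1) * pi"
proof -
  have bound: "- pi < swept_angle p q d z - d \<and> swept_angle p q d z - d < pi"
    if "p \<noteq> q" "- pi < d" "d < pi" "z \<notin> arc_edge p q d" for p q d z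
  proof -
    have "z \<noteq> p" "z \<noteq> q" using that endpoints_in_arc_edge by blast+
    then have "(q - z) / (p - z) * cis (- d) \<notin> \<real>\<^sub>\<le>\<^sub>0"
      using that in_arc_edge_iff_nonpos_Reals by blast
    then have "Arg ((q - z) / (p - z) * cis (- d)) \<noteq> pi"
      unfolding Arg_eq_pi complex_nonpos_Reals_iff by auto
    then show ?thesis
      using mpi_less_Arg[of "(q - z) / (p - z) * cis (- d)"]
        Arg_le_pi[of "(q - z) / (p - z) * cis (- d)"]
      unfolding swept_angle_def by linarith
  qed
  show "- pi < \<phi>0" "\<phi>0 < pi" "- pi < \<phi>1" "\<phi>1 < pi" "- pi < \<phi>2" "\<phi>2 < pi"
    using bound opposite_not_in_edge distinct bulge by (auto simp: \<phi>0_def \<phi>1_def \<phi>2_def)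
  have "cis (a + b + c + \<phi>0 + \<phi>1 + \<phi>2) =
      cis (swept_angle v w b u) * cis (swept_angle w u c v) * cis (swept_angle u v a w)"
    by (simp add: \<phi>0_def \<phi>1_def \<phi>2_def cis_mult add_ac)
  also have "\<dots> = sgn ((w - u) / (v - u)) * sgn ((u - v) / (w - v)) * sgn ((v - w) / (u - w))"
    using distinct by (simp add: cis_swept_angle)
  also have "\<dots> = sgn ((w - u) / (v - u) * ((u - v) / (w - v)) * ((v - w) / (u - w)))"
    by (simp add: sgn_mult)
  also have "(w - u) / (v - u) * ((u - v) / (w - v)) * ((v - w) / (u - w)) = - 1"
    using distinct by (simp add: divide_simps) (simp add: algebra_simps)
  finally have "cos (a + b + c + \<phi>0 + \<phi>1 + \<phi>2 - pi) = 1"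
    by (simp add: complex_eq_iff sgn_minus)
  then obtain m :: int where "a + b + c + \<phi>0 + \<phi>1 + \<phi>2 - pi = real_of_int m * 2 * pi"
    unfolding cos_one_2pi_int by blast
  then show "\<exists>m. a + b + c + \<phi>0 + \<phi>1 + \<phi>2 = real_of_int (2 * m + 1) * pi"
    by (intro exI[of _ m]) (simp add: algebra_simps)
qed

end

section \<open>From indexed to named vertices\<close>

lemma all_less_3: "(\<forall>i<3. P i) \<longleftrightarrow> P 0 \<and> P 1 \<and> P (2::nat)"
  by (auto simp: numeral_3_eq_3 numeral_2_eq_2 less_Suc_eq)

lemma simple_arc_triangle_iff:
  "simple_arc_triangle v a \<longleftrightarrow> arc_triangle (v 0) (v 1) (v 2) (a 0) (a 1) (a 2)"
proof -
  have mods: "(0 + 1) mod 3 = (1::nat)" "(1 + 1) mod 3 = (2::nat)" "(2 + 1) mod 3 = (0::nat)"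
    by auto
  have neqs: "(0::nat) \<noteq> 1" "(1::nat) \<noteq> 0" "(0::nat) \<noteq> 2" "(2::nat) \<noteq> 0" "(1::nat) \<noteq> 2" "(2::nat) \<noteq> 1"
    by auto
  \<comment> \<open>Both orders of each pair appear because simplicity quantifies over ordered pairs
    of edges.\<close>
  have shared: "{v k |k. k < 3 \<and> (k = 0 \<or> k = 1) \<and> (k = 1 \<or> k = 2)} = {v 1}"
    "{v k |k. k < 3 \<and> (k = 1 \<or> k = 2) \<and> (k = 0 \<or> k = 1)} = {v 1}"
    "{v k |k. k < 3 \<and> (k = 1 \<or> k = 2) \<and> (k = 2 \<or> k = 0)} = {v 2}"
    "{v k |k. k < 3 \<and> (k = 2 \<or> k = 0) \<and> (k = 1 \<or> k = 2)} = {v 2}"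
    "{v k |k. k < 3 \<and> (k = 2 \<or> k = 0) \<and> (k = 0 \<or> k = 1)} = {v 0}"
    "{v k |k. k < 3 \<and> (k = 0 \<or> k = 1) \<and> (k = 2 \<or> k = 0)} = {v 0}"
    by auto
  show ?thesis
    unfolding simple_arc_triangle_def is_arc_triangle_def arc_triangle_def all_less_3 tri_edge_def
      mods shared
    by (simp only: simp_thms neqs Int_commute conj_assoc) (intro iffI conjI; elim conjE; assumption)
qed

lemma interior_angle_eq:
  assumes "arc_triangle (v 0) (v 1) (v 2) (a 0) (a 1) (a 2)"
  shows "interior_angle v a i =
    angle_through (inside (arc_triangle.boundary (v 0) (v 1) (v 2) (a 0) (a 1) (a 2))) (v i)"
proof -
  have "{..<3::nat} = {0, 1, 2}" by auto
  then have "tri_boundary v a = arc_triangle.boundary (v 0) (v 1) (v 2) (a 0) (a 1) (a 2)"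
    unfolding tri_boundary_def tri_edge_def arc_triangle.boundary_def[OF assms]
    by (simp add: Un_assoc numeral_2_eq_2)
  then show ?thesis
    by (simp add: interior_angle_def tri_interior_def)
qed

section \<open>Necessity\<close>

text \<open>Eliminating \<open>A\<close> turns each quantity to be bounded into the matching \<phi>
  minus \<open>m * pi\<close>. For m = 0 the bounds are those of \<phi>. For m = 1 any two \<phi>
  sum to at least \<open>pi\<close>, so all are positive; for m = -1 any two sum to at most
  \<open>- pi\<close>, so all are negative.\<close>

lemma angle_defect_bound:
  fixes \<theta>0 \<theta>1 \<theta>2 A \<phi>0 \<phi>1 \<phi>2 :: real and m :: int
  assumes "0 \<le> \<theta>0" "\<theta>0 \<le> 2 * pi" "0 \<le> \<theta>1" "\<theta>1 \<le> 2 * pi" "0 \<le> \<theta>2" "\<theta>2 \<le> 2 * pi"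
    and \<phi>: "- pi < \<phi>0" "\<phi>0 < pi" "- pi < \<phi>1" "\<phi>1 < pi" "- pi < \<phi>2" "\<phi>2 < pi"
    and \<theta>: "\<theta>0 = A + \<phi>0" "\<theta>1 = A + \<phi>1" "\<theta>2 = A + \<phi>2"
    and sum: "A + \<phi>0 + \<phi>1 + \<phi>2 = real_of_int (2 * m + 1) * pi"
  shows "- pi < (pi - \<theta>0 - \<theta>1 - \<theta>2) / 2 + \<theta>0" "(pi - \<theta>0 - \<theta>1 - \<theta>2) / 2 + \<theta>0 < pi"
    "- pi < (pi - \<theta>0 - \<theta>1 - \<theta>2) / 2 + \<theta>1" "(pi - \<theta>0 - \<theta>1 - \<theta>2) / 2 + \<theta>1 < pi"
    "- pi < (pi - \<theta>0 - \<theta>1 - \<theta>2) / 2 + \<theta>2" "(pi - \<theta>0 - \<theta>1 - \<theta>2) / 2 + \<theta>2 < pi"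
proof -
  \<comment> \<open>The odd multiple equals \<open>\<theta>0 + \<phi>1 + \<phi>2\<close>.\<close>
  have "real_of_int (2 * m + 1) * pi < 4 * pi" "- 2 * pi < real_of_int (2 * m + 1) * pi"
    using assms by linarith+
  then have "real_of_int (2 * m + 1) < 4" "- 2 < real_of_int (2 * m + 1)"
    by (simp_all only: mult_less_cancel_right) auto
  then have "m = - 1 \<or> m = 0 \<or> m = 1" by linarith
  then show "- pi < (pi - \<theta>0 - \<theta>1 - \<theta>2) / 2 + \<theta>0" "(pi - \<theta>0 - \<theta>1 - \<theta>2) / 2 + \<theta>0 < pi"
    "- pi < (pi - \<theta>0 - \<theta>1 - \<theta>2) / 2 + \<theta>1" "(pi - \<theta>0 - \<theta>1 - \<theta>2) / 2 + \<theta>1 < pi"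
    "- pi < (pi - \<theta>0 - \<theta>1 - \<theta>2) / 2 + \<theta>2" "(pi - \<theta>0 - \<theta>1 - \<theta>2) / 2 + \<theta>2 < pi"
    using assms by (auto simp: field_simps)
qed

section \<open>Sufficiency\<close>

text \<open>Unless both angles vanish, imaginary parts give them the same sign, and conjugation
  makes both positive. Then \<open>sin (\<phi> + \<eta>)\<close> is nonnegative by the bound on the
  sum, but negative by the real part.\<close>

lemma cis_combination_neq_minus_one:
  assumes "A > 0" "B > 0" "\<bar>\<phi>\<bar> < pi" "\<bar>\<eta>\<bar> < pi" "\<bar>\<phi> + \<eta>\<bar> \<le> pi"
  shows "complex_of_real A * cis (- \<phi>) + complex_of_real B * cis \<eta> \<noteq> - 1"
proof -
  have pos: False
    if "A > 0" "B > 0" "0 < \<phi>" "\<phi> < pi" "\<bar>\<eta>\<bar> < pi" "\<phi> + \<eta> \<le> pi"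
      "A * cos \<phi> + B * cos \<eta> = - 1" "B * sin \<eta> = A * sin \<phi>" for A B \<phi> \<eta> :: real
  proof -
    have "sin \<phi> > 0" using that sin_gt_zero by auto
    then have "sin \<eta> > 0" using that by (metis mult_pos_pos zero_less_mult_pos)
    then have "\<eta> > 0"
      using that sin_ge_zero[of "- \<eta>"] by (cases "\<eta> > 0") auto
    then have "B * sin (\<phi> + \<eta>) \<ge> 0"
      using that by (intro mult_nonneg_nonneg sin_ge_zero) auto
    also have "B * sin (\<phi> + \<eta>) = sin \<phi> * (A * cos \<phi> + B * cos \<eta>)"
      using that(8) by (simp add: sin_add algebra_simps)
    finally show False using \<open>sin \<phi> > 0\<close> that by simp
  qed
  show ?thesis
  proof
    assume "complex_of_real A * cis (- \<phi>) + complex_of_real B * cis \<eta> = - 1"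
    then have eq: "A * cos \<phi> + B * cos \<eta> = - 1" "B * sin \<eta> = A * sin \<phi>"
      by (auto simp: complex_eq_iff)
    consider "\<phi> > 0" | "\<phi> < 0" | "\<phi> = 0" by linarith
    then show False
    proof cases
      case 1
      show False by (rule pos[of A B \<phi> \<eta>]) (use assms eq 1 in auto)
    next
      case 2
      show False by (rule pos[of A B "- \<phi>" "- \<eta>"]) (use assms eq 2 in auto)
    next
      case 3
      then have "\<eta> = 0" using eq assms sin_eq_0_pi[of \<eta>] by auto
      then show False using 3 eq assms by auto
    qed
  qed
qed

lemma rcis_not_nonpos:
  assumes "r > 0" "\<bar>\<phi>\<bar> < pi"
  shows "complex_of_real r * cis \<phi> \<notin> \<real>\<^sub>\<le>\<^sub>0"
proof -
  have "- pi < \<phi>" "\<phi> < pi" using assms by auto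
  then show ?thesis
    using assms sin_eq_0_pi[of \<phi>] by (auto simp: complex_nonpos_Reals_iff mult_le_0_iff)
qed

text \<open>The deviations \<open>\<phi>\<close> and \<open>\<eta>\<close> are the angles between the arcs and the circumcircle. Sending
  \<open>x\<close> to infinity turns the arcs into two rays, which cross only if \<open>\<bar>\<phi> + \<eta>\<bar> > \<pi>\<close>.\<close>

lemma arc_edges_Int:
  assumes ne: "p \<noteq> x" "x \<noteq> q" "q \<noteq> p"
    and ab: "- pi < a" "a < pi" "- pi < b" "b < pi"
    and r: "r > 0" "(q - p) / (x - p) * cis (- b) = complex_of_real r * cis \<phi>"
    and s: "s > 0" "(x - q) / (p - q) * cis (- a) = complex_of_real s * cis \<eta>"
    and ang: "\<bar>\<phi>\<bar> < pi" "\<bar>\<eta>\<bar> < pi" "\<bar>\<phi> + \<eta>\<bar> \<le> pi"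
  shows "arc_edge p x a \<inter> arc_edge x q b \<subseteq> {x}"
proof
  fix z assume z: "z \<in> arc_edge p x a \<inter> arc_edge x q b"
  have p: "p \<notin> arc_edge x q b"
    using ne ab rcis_not_nonpos[OF r(1) ang(1)] by (subst in_arc_edge_iff_nonpos_Reals) (auto simp only: r)
  have q: "q \<notin> arc_edge p x a"
    using ne ab rcis_not_nonpos[OF s(1) ang(2)] by (subst in_arc_edge_iff_nonpos_Reals) (auto simp only: s)
  show "z \<in> {x}"
  proof (rule ccontr)
    assume "z \<notin> {x}"
    then have zx: "z \<noteq> x" by simp
    have "z \<noteq> p" "z \<noteq> q" using z p q by auto
    then obtain k l where k: "k > 0" "x - z = - (complex_of_real k * cis a * (p - z))"
      and l: "l > 0" "q - z = - (complex_of_real l * cis b * (x - z))"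
      using z zx unfolding Int_iff arc_edge_iff[OF ne(1) ab(1,2)] arc_edge_iff[OF ne(2) ab(3,4)] by blast
    define y where "y = z - x"
    define P where "P = p - x"
    define Q where "Q = q - x"
    define D where "D = Q - P"
    have D0: "D \<noteq> 0" using ne by (simp add: D_def P_def Q_def)
    have ca: "cis (- a) * cis a = 1" "cis (- b) * cis b = 1" "cis \<phi> * cis (- \<phi>) = 1"
      by (simp_all add: cis_mult)
    have y0: "y \<noteq> 0" using zx by (simp add: y_def)
    have Qy: "Q = y * (1 + complex_of_real l * cis b)"
      using l(2) by (simp add: Q_def y_def algebra_simps)
    have "y = complex_of_real k * cis a * (P - y)"
      using k(2) by (simp add: P_def y_def algebra_simps)
    then have "complex_of_real (1 / k) * cis (- a) * y = complex_of_real (1 / k) * cis (- a) * (complex_of_real k * cis a * (P - y))"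
      by simp
    also have "\<dots> = complex_of_real (1 / k) * complex_of_real k * (cis (- a) * cis a) * (P - y)"
      by (simp only: mult_ac)
    also have "\<dots> = P - y" using k(1) ca by simp
    finally have Py: "P = y * (1 + complex_of_real (1 / k) * cis (- a))"
      by (simp add: algebra_simps)
    \<comment> \<open>In the coordinate \<open>1 / y\<close>, which sends \<open>x\<close> to
      infinity, the arcs are rays from \<open>1 / P\<close> and \<open>1 / Q\<close>; eliminating
      \<open>y\<close> expresses that they meet.\<close>
    have "Q * (1 + complex_of_real (1 / k) * cis (- a)) = P * (1 + complex_of_real l * cis b)"
      unfolding Qy Py by (simp only: mult_ac)
    then have 1: "D = complex_of_real l * (P * cis b) - complex_of_real (1 / k) * (Q * cis (- a))"
      by (simp add: D_def algebra_simps)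
    \<comment> \<open>The angle data at \<open>p\<close> and \<open>q\<close> make
      \<open>P * cis b\<close> and \<open>Q * cis (- a)\<close> multiples of the chord
      \<open>D\<close>, which then cancels.\<close>
    have "D * cis (- b) = complex_of_real r * cis \<phi> * (- P)"
      using r(2) ne by (simp add: D_def P_def Q_def field_simps)
    then have "complex_of_real (1 / r) * (D * cis (- b)) * cis b * cis (- \<phi>) =
        complex_of_real (1 / r) * (complex_of_real r * cis \<phi> * (- P)) * cis b * cis (- \<phi>)"
      by simp
    also have "\<dots> = complex_of_real (1 / r) * complex_of_real r * (cis \<phi> * cis (- \<phi>)) * (- P) * cis b"
      by (simp only: mult_ac)
    also have "\<dots> = - P * cis b" using r(1) ca by simp
    also have "complex_of_real (1 / r) * (D * cis (- b)) * cis b * cis (- \<phi>) =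
        complex_of_real (1 / r) * D * (cis (- b) * cis b) * cis (- \<phi>)"
      by (simp only: mult_ac)
    finally have 2: "P * cis b = - (complex_of_real (1 / r) * D * cis (- \<phi>))"
      using ca by simp
    have 3: "Q * cis (- a) = complex_of_real s * D * cis \<eta>"
      using s(2) ne by (simp add: D_def P_def Q_def field_simps)
    have "D = (- (complex_of_real (l / r) * cis (- \<phi>)) - complex_of_real (s / k) * cis \<eta>) * D"
      using 1 unfolding 2 3 by (simp add: algebra_simps)
    then have "- (complex_of_real (l / r) * cis (- \<phi>)) - complex_of_real (s / k) * cis \<eta> = 1"
      using D0 by simp
    then have "complex_of_real (l / r) * cis (- \<phi>) + complex_of_real (s / k) * cis \<eta> = - 1"
      by (metis minus_add_distrib minus_minus uminus_add_conv_diff add.commute)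
    then show False
      using cis_combination_neq_minus_one[of "l / r" "s / k" \<phi> \<eta>] k(1) l(1) r(1) s(1) ang by auto
  qed
qed

section \<open>Triangles inscribed in the unit circle\<close>

lemma cis_double_diff: "cis (2 * x) - cis (2 * y) = 2 * \<i> * complex_of_real (sin (x - y)) * cis (x + y)"
proof -
  have "cis (2 * x) - cis (2 * y) = cis (x + y) * (cis (x - y) - cis (- (x - y)))"
    by (simp add: right_diff_distrib cis_mult)
  also have "cis d - cis (- d) = 2 * \<i> * complex_of_real (sin d)" for d
    by (simp add: complex_eq_iff)
  finally show ?thesis by (simp only: mult_ac)
qed

text \<open>Half angles remove the apex \<open>cis (2 * y)\<close> from the direction; this is the
  inscribed angle theorem.\<close>

lemma inscribed_angle:
  assumes "sin (z - y) \<noteq> 0"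
  shows "(cis (2 * x) - cis (2 * y)) / (cis (2 * z) - cis (2 * y)) =
    complex_of_real (sin (x - y) / sin (z - y)) * cis (x - z)"
proof -
  have "cis (x + y) / cis (z + y) = cis (x - z)"
    by (simp add: cis_divide)
  then show ?thesis
    unfolding cis_double_diff using assms by (simp add: field_simps)
qed

text \<open>Each bulge is the opposite angle of an inscribed triangle minus the deviation, so the
  edge is seen from the opposite vertex under bulge plus deviation. Zero deviations would give arcs
  of the circle itself.\<close>

lemma arc_triangle_with_deviations:
  assumes \<phi>: "- pi < \<phi>0" "\<phi>0 < pi" "- pi < \<phi>1" "\<phi>1 < pi" "- pi < \<phi>2" "\<phi>2 < pi"
    and sum: "\<bar>\<phi>0 + \<phi>1\<bar> \<le> pi" "\<bar>\<phi>1 + \<phi>2\<bar> \<le> pi" "\<bar>\<phi>2 + \<phi>0\<bar> \<le> pi"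
  obtains u v w a b c where "arc_triangle u v w a b c"
    "swept_angle v w b u = b + \<phi>0" "swept_angle w u c v = c + \<phi>1" "swept_angle u v a w = a + \<phi>2"
    "a + b + c = pi - \<phi>0 - \<phi>1 - \<phi>2"
proof -
  \<comment> \<open>The inscribed angles must be positive, sum to \<open>pi\<close> and stay below
    \<open>pi + \<phi>\<close>, which keeps the bulges below \<open>pi\<close>. Scaling
    \<open>pi + \<phi>\<close> by \<open>pi / S\<close> achieves this; \<open>S > pi\<close> because
    a pair sum is at least \<open>- pi\<close> and the third deviation exceeds
    \<open>- pi\<close>.\<close>
  define S where "S = 3 * pi + \<phi>0 + \<phi>1 + \<phi>2"
  have S: "S > pi" using \<phi> sum unfolding S_def by linarith
  define \<alpha> where "\<alpha> = (\<lambda>\<phi>. (pi + \<phi>) * (pi / S))"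
  have \<alpha>: "0 < \<alpha> \<phi>" "\<alpha> \<phi> < pi + \<phi>" if "- pi < \<phi>" for \<phi>
  proof -
    have "0 < pi / S" "pi / S < 1" using S by (auto simp: less_trans[OF pi_gt_zero])
    moreover have "0 < pi + \<phi>" using that by simp
    ultimately show "0 < \<alpha> \<phi>" "\<alpha> \<phi> < pi + \<phi>"
      unfolding \<alpha>_def using mult_strict_left_mono[of "pi / S" 1 "pi + \<phi>"]
      by (simp_all only: mult_pos_pos mult_1_right)
  qed
  have sum\<alpha>: "\<alpha> \<phi>0 + \<alpha> \<phi>1 + \<alpha> \<phi>2 = pi"
  proof -
    have "(pi + \<phi>0) * t + (pi + \<phi>1) * t + (pi + \<phi>2) * t = S * t" for t
      by (simp add: S_def algebra_simps)
    then have "\<alpha> \<phi>0 + \<alpha> \<phi>1 + \<alpha> \<phi>2 = S * (pi / S)"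
      unfolding \<alpha>_def .
    then show ?thesis using S pi_gt_zero by auto
  qed
  define a0 where "a0 = \<alpha> \<phi>0"
  define a1 where "a1 = \<alpha> \<phi>1"
  define a2 where "a2 = \<alpha> \<phi>2"
  have pos: "0 < a0" "0 < a1" "0 < a2" and lt: "a0 < pi + \<phi>0" "a1 < pi + \<phi>1" "a2 < pi + \<phi>2"
    and a_sum: "a0 + a1 + a2 = pi"
    using \<alpha> \<phi> sum\<alpha> by (auto simp: a0_def a1_def a2_def)
  have sins: "sin a0 > 0" "sin a1 > 0" "sin a2 > 0" "sin (a2 + a0) > 0"
    using pos a_sum by (auto intro!: sin_gt_zero)
  \<comment> \<open>Central angles are twice inscribed ones, so the angles at \<open>u\<close>,
    \<open>v\<close>, \<open>w\<close> are \<open>a0\<close>, \<open>a1\<close>,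
    \<open>a2\<close>.\<close>
  define u where "u = cis (2 * 0)"
  define v where "v = cis (2 * a2)"
  define w where "w = cis (2 * (a2 + a0))"
  define a where "a = a2 - \<phi>2"
  define b where "b = a0 - \<phi>0"
  define c where "c = a1 - \<phi>1"
  have ne: "u \<noteq> v" "v \<noteq> w" "w \<noteq> u"
  proof -
    have "v - u \<noteq> 0" "w - v \<noteq> 0" "w - u \<noteq> 0"
      unfolding u_def v_def w_def cis_double_diff using sins by auto
    then show "u \<noteq> v" "v \<noteq> w" "w \<noteq> u" by auto
  qed
  have bul: "- pi < a" "a < pi" "- pi < b" "b < pi" "- pi < c" "c < pi"
    using pos lt \<phi> by (auto simp: a_def b_def c_def)
  have 0: "(w - u) / (v - u) * cis (- b) = complex_of_real (sin (a2 + a0) / sin a2) * cis \<phi>0"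
    unfolding u_def v_def w_def using sins
    by (subst inscribed_angle) (auto simp: b_def cis_mult mult.assoc)
  \<comment> \<open>This minus sign cancels the one from \<open>sin (- a2)\<close> in the ratio at
    \<open>v\<close>.\<close>
  have c1: "cis (- a2 - a0) = - cis a1"
  proof -
    have "- a2 - a0 = a1 - pi" using a_sum by simp
    then show ?thesis by (simp add: complex_eq_iff)
  qed
  have 1: "(u - v) / (w - v) * cis (- c) = complex_of_real (sin a2 / sin a0) * cis \<phi>1"
  proof -
    have m: "0 - a2 = - a2" "a2 + a0 - a2 = a0" "0 - (a2 + a0) = - a2 - a0" by auto
    have "(u - v) / (w - v) = complex_of_real (sin a2 / sin a0) * cis a1"
      unfolding u_def v_def w_def using sins
      by (subst inscribed_angle) (simp_all only: m sin_minus c1, simp_all)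
    then show ?thesis by (simp add: c_def cis_mult mult.assoc)
  qed
  have 2: "(v - w) / (u - w) * cis (- a) = complex_of_real (sin a0 / sin (a2 + a0)) * cis \<phi>2"
  proof -
    have m: "0 - (a2 + a0) = - (a2 + a0)" "a2 - (a2 + a0) = - a0" by auto
    have "(v - w) / (u - w) = complex_of_real (sin a0 / sin (a2 + a0)) * cis a2"
      unfolding u_def v_def w_def using sins
      by (subst inscribed_angle) (simp_all only: m sin_minus, simp_all)
    then show ?thesis by (simp add: a_def cis_mult mult.assoc)
  qed
  have r: "sin (a2 + a0) / sin a2 > 0" "sin a2 / sin a0 > 0" "sin a0 / sin (a2 + a0) > 0"
    using sins by auto
  have abs: "\<bar>\<phi>0\<bar> < pi" "\<bar>\<phi>1\<bar> < pi" "\<bar>\<phi>2\<bar> < pi" using \<phi> by auto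
  have arg: "Arg (complex_of_real k * cis \<phi>) = \<phi>" if "k > 0" "\<bar>\<phi>\<bar> < pi" for k \<phi>
    by (rule Arg_unique'[of k]) (use that in \<open>auto simp: rcis_def\<close>)
  show ?thesis
  proof
    show "arc_triangle u v w a b c"
    proof
      show "arc_edge u v a \<inter> arc_edge v w b \<subseteq> {v}"
        by (rule arc_edges_Int[OF ne bul(1-4) r(1) 0 r(3) 2]) (use abs sum in \<open>auto simp: add.commute\<close>)
      show "arc_edge v w b \<inter> arc_edge w u c \<subseteq> {w}"
        by (rule arc_edges_Int[OF ne(2,3,1) bul(3-6) r(2) 1 r(1) 0]) (use abs sum in \<open>auto simp: add.commute\<close>)
      show "arc_edge w u c \<inter> arc_edge u v a \<subseteq> {u}"
        by (rule arc_edges_Int[OF ne(3,1,2) bul(5,6,1,2) r(3) 2 r(2) 1]) (use abs sum in \<open>auto simp: add.commute\<close>)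
    qed (use ne bul in auto)
    show "swept_angle v w b u = b + \<phi>0" "swept_angle w u c v = c + \<phi>1" "swept_angle u v a w = a + \<phi>2"
      unfolding swept_angle_def 0 1 2 arg[OF r(1) abs(1)] arg[OF r(2) abs(2)] arg[OF r(3) abs(3)]
      by (rule refl)+
    show "a + b + c = pi - \<phi>0 - \<phi>1 - \<phi>2"
      using a_sum by (simp add: a_def b_def c_def)
  qed
qed

theorem mainTheorem4:
  fixes \<theta>0 \<theta>1 \<theta>2 :: real
  assumes "0 \<le> \<theta>0" "\<theta>0 \<le> 2 * pi"
    and "0 \<le> \<theta>1" "\<theta>1 \<le> 2 * pi"
    and "0 \<le> \<theta>2" "\<theta>2 \<le> 2 * pi"
  shows "(\<exists>v a. simple_arc_triangle v a \<and>
            interior_angle v a 0 = \<theta>0 \<and> interior_angle v a 1 = \<theta>1 \<and>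
            interior_angle v a 2 = \<theta>2)
         \<longleftrightarrow>
         (let \<psi> = (pi - \<theta>0 - \<theta>1 - \<theta>2) / 2 in
            - pi < \<psi> + \<theta>0 \<and> \<psi> + \<theta>0 < pi \<and>
            - pi < \<psi> + \<theta>1 \<and> \<psi> + \<theta>1 < pi \<and>
            - pi < \<psi> + \<theta>2 \<and> \<psi> + \<theta>2 < pi)"
    (is "?L \<longleftrightarrow> ?R")
proof
  assume ?L
  then obtain v a where T: "simple_arc_triangle v a" and
    \<theta>: "interior_angle v a 0 = \<theta>0" "interior_angle v a 1 = \<theta>1" "interior_angle v a 2 = \<theta>2"
    by blast
  interpret arc_triangle "v 0" "v 1" "v 2" "a 0" "a 1" "a 2"
    using T by (simp only: simple_arc_triangle_iff)
  note \<theta>' = \<theta>[unfolded interior_angle_eq[OF arc_triangle_axioms]]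
  define A where "A = a 0 + a 1 + a 2"
  define \<phi>0 where "\<phi>0 = swept_angle (v 1) (v 2) (a 1) (v 0) - a 1"
  define \<phi>1 where "\<phi>1 = swept_angle (v 2) (v 0) (a 2) (v 1) - a 2"
  define \<phi>2 where "\<phi>2 = swept_angle (v 0) (v 1) (a 0) (v 2) - a 0"
  note \<phi> = opposite_swept_angles[folded \<phi>0_def \<phi>1_def \<phi>2_def]
  obtain m :: int where m: "A + \<phi>0 + \<phi>1 + \<phi>2 = real_of_int (2 * m + 1) * pi"
    using \<phi>(7) unfolding A_def by blast
  obtain \<sigma> :: real where \<sigma>: "\<sigma> = 1 \<or> \<sigma> = - 1"
    and eq: "\<theta>0 = \<sigma> * (A + \<phi>0)" "\<theta>1 = \<sigma> * (A + \<phi>1)" "\<theta>2 = \<sigma> * (A + \<phi>2)"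
    using interior_angles unfolding \<theta>' A_def \<phi>0_def \<phi>1_def \<phi>2_def
    by (auto simp: algebra_simps)
  from \<sigma> show ?R
  proof
    assume "\<sigma> = 1"
    then show ?R
      using angle_defect_bound[OF assms \<phi>(1-6) _ _ _ m] eq by (simp add: Let_def)
  next
    assume "\<sigma> = - 1"
    then have eq': "\<theta>0 = - A + - \<phi>0" "\<theta>1 = - A + - \<phi>1" "\<theta>2 = - A + - \<phi>2"
      using eq by auto
    \<comment> \<open>Reversing the orientation negates everything, and the negative of
      \<open>2 * m + 1\<close> is again odd.\<close>
    have "- A + - \<phi>0 + - \<phi>1 + - \<phi>2 = real_of_int (2 * (- m - 1) + 1) * pi"
      using m by (simp add: algebra_simps)
    from angle_defect_bound[OF assms _ _ _ _ _ _ eq' this] \<phi>(1-6) show ?R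
      by (simp add: Let_def)
  qed
next
  assume R: ?R
  define \<psi> where "\<psi> = (pi - \<theta>0 - \<theta>1 - \<theta>2) / 2"
  have \<phi>: "- pi < \<psi> + \<theta>0" "\<psi> + \<theta>0 < pi" "- pi < \<psi> + \<theta>1" "\<psi> + \<theta>1 < pi"
    "- pi < \<psi> + \<theta>2" "\<psi> + \<theta>2 < pi"
    using R by (auto simp: Let_def \<psi>_def)
  \<comment> \<open>Each pair sum is \<open>pi\<close> minus the third prescribed angle, which lies
    between 0 and \<open>2 * pi\<close>.\<close>
  have sum: "\<bar>(\<psi> + \<theta>0) + (\<psi> + \<theta>1)\<bar> \<le> pi" "\<bar>(\<psi> + \<theta>1) + (\<psi> + \<theta>2)\<bar> \<le> pi"
    "\<bar>(\<psi> + \<theta>2) + (\<psi> + \<theta>0)\<bar> \<le> pi"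
    using assms by (auto simp: \<psi>_def field_simps abs_le_iff)
  obtain u v w a b c where T: "arc_triangle u v w a b c"
    and sw: "swept_angle v w b u = b + (\<psi> + \<theta>0)" "swept_angle w u c v = c + (\<psi> + \<theta>1)"
      "swept_angle u v a w = a + (\<psi> + \<theta>2)"
    and tot: "a + b + c = pi - (\<psi> + \<theta>0) - (\<psi> + \<theta>1) - (\<psi> + \<theta>2)"
    by (rule arc_triangle_with_deviations[OF \<phi> sum])
  interpret arc_triangle u v w a b c by (rule T)
  \<comment> \<open>With this total, adding \<open>\<psi> + \<theta>0\<close> leaves exactly
    \<theta>0, and likewise at the other vertices.\<close>
  have tot': "a + b + c = - \<psi>"
    using tot by (simp add: \<psi>_def field_simps)
  obtain \<sigma> :: real where \<sigma>: "\<sigma> = 1 \<or> \<sigma> = - 1"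
    and ang: "angle_through (inside boundary) u = \<sigma> * (a + c + swept_angle v w b u)"
    "angle_through (inside boundary) v = \<sigma> * (b + a + swept_angle w u c v)"
    "angle_through (inside boundary) w = \<sigma> * (c + b + swept_angle u v a w)"
    by (rule interior_angles)
  have "a + c + swept_angle v w b u = \<theta>0" "b + a + swept_angle w u c v = \<theta>1"
    "c + b + swept_angle u v a w = \<theta>2"
    using tot' sw by linarith+
  note ang = ang[unfolded this]
  have nonneg: "angle_through X y \<ge> 0" for X y
    by (simp add: angle_through_def)
  text \<open>A negative sign is possible only if all three angles vanish.\<close>
  have fin: "angle_through (inside boundary) u = \<theta>0" "angle_through (inside boundary) v = \<theta>1"
    "angle_through (inside boundary) w = \<theta>2"
    using \<sigma> ang assms nonneg[of "inside boundary" u] nonneg[of "inside boundary" v]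
      nonneg[of "inside boundary" w]
    by auto
  define V where "V = (\<lambda>i::nat. if i = 0 then u else if i = 1 then v else w)"
  define B where "B = (\<lambda>i::nat. if i = 0 then a else if i = 1 then b else c)"
  have V: "V 0 = u" "V 1 = v" "V 2 = w" "B 0 = a" "B 1 = b" "B 2 = c"
    by (simp_all add: V_def B_def)
  have "simple_arc_triangle V B"
    unfolding simple_arc_triangle_iff V by (rule T)
  moreover have "interior_angle V B i = angle_through (inside boundary) (V i)" for i
    using interior_angle_eq[of V B i] T unfolding V by blast
  ultimately show ?L
    using fin V by (intro exI[of _ V] exI[of _ B]) simp
qed

end
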